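(* Let $d\ge3$ and $\lambda>0$. Let $S$ and $S'$ be two independent network random walks on $\Gamma_d(\lambda)$ with arbitrary (possibly random) initial points $S_0$ and $S_0'$. Then, almost surely, the paths of $S$ and $S'$ cross only finitely many times, i.e. there are only finitely many pairs $(m,m')\in\mathbb{Z}_+^2$ with $S_m=S'_{m'}$.
   Context: $\Gamma_d(\lambda)$ is the nearest-neighbour lattice graph on $\mathbb{Z}^{d+1}=\mathbb{Z}\times\mathbb{Z}^d$ with conductance $\mu((n,x),(n',x'))=e^{\lambda\max(n,n')}$ on each edge $(n,x)\sim(n',x')$. The network random walk is the Markov chain which jumps to a neighbour with probability proportional to the conductance of the connecting edge; equivalently, its i.i.d. steps equal $(1,0)$ with probability $e^\lambda/(2d+1+e^\lambda)$ and each of the other $2d+1$ signed unit vectors with probability $1/(2d+1+e^\lambda)$. *)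

theory Defs
  imports "HOL-Probability.Probability"
begin

text \<open>The dimension \<open>d\<close> is the cardinality of the index type \<open>'d\<close>.\<close>

type_synonym 'd vertex = "int \<times> (int ^ 'd)"

definition adjacent :: "('d::finite) vertex \<Rightarrow> 'd vertex \<Rightarrow> bool" where
  "adjacent u v \<longleftrightarrow> \<bar>fst u - fst v\<bar> + (\<Sum>i\<in>UNIV. \<bar>snd u $ i - snd v $ i\<bar>) = 1"

definition conductance :: "real \<Rightarrow> ('d::finite) vertex \<Rightarrow> 'd vertex \<Rightarrow> real" where
  "conductance lam u v =
    (if adjacent u v then exp (lam * real_of_int (max (fst u) (fst v))) else 0)"

definition step_prob :: "real \<Rightarrow> ('d::finite) vertex \<Rightarrow> 'd vertex \<Rightarrow> real" where
  "step_prob lam u v = conductance lam u v / (\<Sum>w | adjacent u w. conductance lam u w)"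

text \<open>The sum in \<^const>\<open>step_prob\<close> is a genuine one: the graph is locally finite.\<close>

lemma finite_neighbours: "finite {w. adjacent (u :: ('d::finite) vertex) w}"
proof -
  let ?I = "\<lambda>k::int. {k - 1..k + 1}"
  let ?B = "{v :: int ^ 'd. \<forall>i. v $ i \<in> ?I (snd u $ i)}"
  have "finite (vec_lambda ` (PiE (UNIV :: 'd set) (\<lambda>i. ?I (snd u $ i))) :: (int ^ 'd) set)"
    by (intro finite_imageI finite_PiE) auto
  moreover have "?B \<subseteq> vec_lambda ` (PiE (UNIV :: 'd set) (\<lambda>i. ?I (snd u $ i)))"
  proof
    fix v assume "v \<in> ?B"
    then show "v \<in> vec_lambda ` (PiE (UNIV :: 'd set) (\<lambda>i. ?I (snd u $ i)))"
      by (intro image_eqI[of _ _ "vec_nth v"]) (auto simp: vec_nth_inverse)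
  qed
  ultimately have "finite (?I (fst u) \<times> ?B)"
    using finite_subset by blast
  moreover have "{w. adjacent u w} \<subseteq> ?I (fst u) \<times> ?B"
  proof
    fix w assume "w \<in> {w. adjacent u w}"
    then have s: "\<bar>fst u - fst w\<bar> + (\<Sum>i\<in>UNIV. \<bar>snd u $ i - snd w $ i\<bar>) = 1"
      by (simp add: adjacent_def)
    have nn: "0 \<le> (\<Sum>i\<in>UNIV. \<bar>snd u $ i - snd w $ i\<bar>)"
      by (simp add: sum_nonneg)
    have "snd w $ i \<in> ?I (snd u $ i)" for i
    proof -
      have "\<bar>snd u $ i - snd w $ i\<bar> \<le> (\<Sum>i\<in>UNIV. \<bar>snd u $ i - snd w $ i\<bar>)"
        by (rule member_le_sum) auto
      then show ?thesis using s by auto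
    qed
    moreover have "fst w \<in> ?I (fst u)"
      unfolding atLeastAtMost_iff using s nn by linarith
    ultimately show "w \<in> ?I (fst u) \<times> ?B"
      by (cases w) auto
  qed
  ultimately show ?thesis by (rule rev_finite_subset)
qed

definition network_random_walk ::
    "'w measure \<Rightarrow> real \<Rightarrow> (nat \<Rightarrow> 'w \<Rightarrow> ('d::finite) vertex) \<Rightarrow> bool" where
  "network_random_walk M lam S \<longleftrightarrow>
    prob_space M \<and>
    (\<forall>n. S n \<in> measurable M (count_space UNIV)) \<and>
    (\<forall>n u v. \<P>(\<omega> in M. \<forall>i\<le>n. S i \<omega> = u i) \<noteq> 0 \<longrightarrow>
      \<P>(\<omega> in M. S (Suc n) \<omega> = v \<bar> \<forall>i\<le>n. S i \<omega> = u i) = step_prob lam (u n) v)"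

abbreviation path_space :: "(nat \<Rightarrow> ('d::finite) vertex) measure" where
  "path_space \<equiv> PiM UNIV (\<lambda>_. count_space UNIV)"

abbreviation start_event ::
    "'w measure \<Rightarrow> (nat \<Rightarrow> 'w \<Rightarrow> ('d::finite) vertex) \<Rightarrow> (nat \<Rightarrow> 'w \<Rightarrow> 'd vertex)
      \<Rightarrow> 'd vertex \<Rightarrow> 'd vertex \<Rightarrow> 'w set" where
  "start_event M S S' a b \<equiv> {\<omega>\<in>space M. S 0 \<omega> = a \<and> S' 0 \<omega> = b}"

text \<open>Arbitrary random initial points: the pair of initial points may have any joint law, and
  given its value \<open>(a, b)\<close> the processes are independent network random walks.  The lemma
  \<open>independent_network_random_walksI\<close> below shows that this covers any two network random
  walks that are (unconditionally) independent as processes.\<close>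

definition independent_network_random_walks ::
    "'w measure \<Rightarrow> real \<Rightarrow> (nat \<Rightarrow> 'w \<Rightarrow> ('d::finite) vertex) \<Rightarrow> (nat \<Rightarrow> 'w \<Rightarrow> 'd vertex) \<Rightarrow> bool"
  where
  "independent_network_random_walks M lam S S' \<longleftrightarrow>
    prob_space M \<and>
    (\<forall>n. S n \<in> measurable M (count_space UNIV)) \<and>
    (\<forall>n. S' n \<in> measurable M (count_space UNIV)) \<and>
    (\<forall>a b. measure M (start_event M S S' a b) \<noteq> 0 \<longrightarrow>
      (let N = uniform_measure M (start_event M S S' a b) in
        network_random_walk N lam S \<and> network_random_walk N lam S' \<and>
        prob_space.indep_var N path_space (\<lambda>\<omega> n. S n \<omega>) path_space (\<lambda>\<omega> n. S' n \<omega>)))"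

lemma path_measurable:
  fixes S :: "nat \<Rightarrow> 'w \<Rightarrow> ('d::finite) vertex"
  assumes "\<And>n. S n \<in> measurable M (count_space UNIV)"
  shows "(\<lambda>\<omega> n. S n \<omega>) \<in> measurable M path_space"
  using assms by (intro measurable_PiM_single') auto

lemma start_in_path_space: "{s. s 0 = (a :: ('d::finite) vertex)} \<in> sets path_space"
proof -
  have "(\<lambda>s. s 0) -` {a} \<inter> space path_space \<in> sets path_space"
    by (rule measurable_sets[of _ _ "count_space UNIV"]) (auto intro: measurable_component_singleton)
  then show ?thesis by (simp add: vimage_def space_PiM)
qed

lemma indep_var_prod:
  assumes "prob_space M" "prob_space.indep_var M P X Q Y" "A \<in> sets P" "B \<in> sets Q"
  shows "measure M {\<omega>\<in>space M. X \<omega> \<in> A \<and> Y \<omega> \<in> B} =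
    measure M {\<omega>\<in>space M. X \<omega> \<in> A} * measure M {\<omega>\<in>space M. Y \<omega> \<in> B}"
proof -
  have eq: "(\<lambda>x. (X x, Y x)) -` (A \<times> B) \<inter> space M = {\<omega>\<in>space M. X \<omega> \<in> A \<and> Y \<omega> \<in> B}"
    "X -` A \<inter> space M = {\<omega>\<in>space M. X \<omega> \<in> A}" "Y -` B \<inter> space M = {\<omega>\<in>space M. Y \<omega> \<in> B}"
    by auto
  show ?thesis
    using prob_space.indep_varD[OF assms] unfolding eq .
qed

lemma indep_var_commute:
  assumes M: "prob_space M" and ind: "prob_space.indep_var M P X Q Y"
  shows "prob_space.indep_var M Q Y P X"
proof -
  have set_comm: "prob_space.indep_set M B A" if "prob_space.indep_set M A B" for A B
  proof (unfold prob_space.indep_sets2_eq[OF M], intro conjI ballI)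
    have AB: "A \<subseteq> sets M" "B \<subseteq> sets M"
        "\<And>a b. a \<in> A \<Longrightarrow> b \<in> B \<Longrightarrow> measure M (a \<inter> b) = measure M a * measure M b"
      using that unfolding prob_space.indep_sets2_eq[OF M] by blast+
    show "B \<subseteq> sets M" "A \<subseteq> sets M" using AB by blast+
    show "measure M (b \<inter> a) = measure M b * measure M a" if "b \<in> B" "a \<in> A" for b a
      using AB(3)[OF that(2,1)] by (simp add: Int_commute mult.commute)
  qed
  show ?thesis
    using ind set_comm unfolding prob_space.indep_var_eq[OF M] by blast
qed

lemma indep_varI:
  assumes M: "prob_space M"
    and X: "X \<in> measurable M P" and Y: "Y \<in> measurable M Q"
    and prod: "\<And>A B. A \<in> sets P \<Longrightarrow> B \<in> sets Q \<Longrightarrow>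
      measure M {\<omega>\<in>space M. X \<omega> \<in> A \<and> Y \<omega> \<in> B} =
      measure M {\<omega>\<in>space M. X \<omega> \<in> A} * measure M {\<omega>\<in>space M. Y \<omega> \<in> B}"
  shows "prob_space.indep_var M P X Q Y"
proof -
  have gen: "sigma_sets (space M) {X -` A \<inter> space M |A. A \<in> sets P} = {X -` A \<inter> space M |A. A \<in> sets P}"
    if "X \<in> measurable M P" for X and P
    using sigma_sets_vimage_commute[of X "space M" "space P" "sets P"] measurable_space[OF that]
    by (auto simp: sets.sigma_sets_eq)
  show ?thesis
    unfolding prob_space.indep_var_eq[OF M] gen[OF X] gen[OF Y]
  proof (intro conjI X Y prob_space.indep_setI[OF M])
    show "{X -` A \<inter> space M |A. A \<in> sets P} \<subseteq> sets M"
      using X by (auto intro: measurable_sets)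
    show "{Y -` A \<inter> space M |A. A \<in> sets Q} \<subseteq> sets M"
      using Y by (auto intro: measurable_sets)
    fix a b assume "a \<in> {X -` A \<inter> space M |A. A \<in> sets P}" "b \<in> {Y -` A \<inter> space M |A. A \<in> sets Q}"
    then obtain A B where AB: "A \<in> sets P" "B \<in> sets Q" "a = X -` A \<inter> space M" "b = Y -` B \<inter> space M"
      by auto
    have eq: "a \<inter> b = {\<omega>\<in>space M. X \<omega> \<in> A \<and> Y \<omega> \<in> B}" "a = {\<omega>\<in>space M. X \<omega> \<in> A}"
      "b = {\<omega>\<in>space M. Y \<omega> \<in> B}"
      using AB by auto
    show "measure M (a \<inter> b) = measure M a * measure M b"
      unfolding eq(1) unfolding eq(2,3) using AB prod by blast
  qed
qed

lemma network_random_walk_conditioned: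
  fixes S S' :: "nat \<Rightarrow> 'w \<Rightarrow> ('d::finite) vertex"
  assumes S: "network_random_walk M lam S"
    and S': "\<And>n. S' n \<in> measurable M (count_space UNIV)"
    and ind: "prob_space.indep_var M path_space (\<lambda>\<omega> n. S n \<omega>) path_space (\<lambda>\<omega> n. S' n \<omega>)"
    and pos: "measure M (start_event M S S' a b) \<noteq> 0"
  shows "network_random_walk (uniform_measure M (start_event M S S' a b)) lam S"
proof -
  let ?E = "start_event M S S' a b"
  let ?N = "uniform_measure M ?E"
  interpret prob_space M using S by (simp add: network_random_walk_def)
  have Sm[measurable]: "S n \<in> measurable M (count_space UNIV)" for n
    using S by (simp add: network_random_walk_def)
  note S'[measurable]
  have E: "?E \<in> sets M" by measurable
  have epos: "emeasure M ?E \<noteq> 0" using pos by (simp add: emeasure_eq_measure)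
  have pN: "prob_space ?N"
    by (rule prob_space_uniform_measure) (use epos in auto)
  let ?q = "prob {\<omega>\<in>space M. S' 0 \<omega> = b}"
  have cyl: "{s :: nat \<Rightarrow> 'd vertex. (\<forall>i\<le>n. s i = u i)} \<in> sets path_space" for n u
  proof -
    have "{s \<in> space path_space. \<forall>i\<le>n. s i = (u i :: 'd vertex)} \<in> sets path_space" by measurable
    then show ?thesis by (simp add: space_PiM)
  qed
  have split: "measure ?N {\<omega>\<in>space M. \<forall>i\<le>n. S i \<omega> = u i} =
      (if u 0 = a then prob {\<omega>\<in>space M. \<forall>i\<le>n. S i \<omega> = u i} * ?q / prob ?E else 0)" for n u
  proof -
    have "measure ?N {\<omega>\<in>space M. \<forall>i\<le>n. S i \<omega> = u i} =
        prob (?E \<inter> {\<omega>\<in>space M. \<forall>i\<le>n. S i \<omega> = u i}) / prob ?E"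
      by (rule measure_uniform_measure) (use epos in auto)
    also have "?E \<inter> {\<omega>\<in>space M. \<forall>i\<le>n. S i \<omega> = u i} = (if u 0 = a then
        {\<omega>\<in>space M. (\<lambda>n. S n \<omega>) \<in> {s. \<forall>i\<le>n. s i = u i} \<and> (\<lambda>n. S' n \<omega>) \<in> {s. s 0 = b}} else {})"
      by auto
    also have "prob \<dots> = (if u 0 = a then prob {\<omega>\<in>space M. \<forall>i\<le>n. S i \<omega> = u i} * ?q else 0)"
      using indep_var_prod[OF prob_space_axioms ind cyl[of n u] start_in_path_space[of b]] by auto
    finally show ?thesis by simp
  qed
  have suc: "{\<omega>\<in>space M. S (Suc n) \<omega> = v \<and> (\<forall>i\<le>n. S i \<omega> = u i)} =
      {\<omega>\<in>space M. \<forall>i\<le>Suc n. S i \<omega> = (u(Suc n := v)) i}" for n u v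
    by (auto simp: le_Suc_eq)
  show ?thesis
    unfolding network_random_walk_def
  proof (intro conjI allI impI pN)
    show "S n \<in> measurable ?N (count_space UNIV)" for n
      using Sm[of n] by (simp add: measurable_def)
    fix n u v
    assume nz: "\<P>(\<omega> in ?N. \<forall>i\<le>n. S i \<omega> = u i) \<noteq> 0"
    then have ua: "u 0 = a" and q: "?q \<noteq> 0" and p: "prob {\<omega>\<in>space M. \<forall>i\<le>n. S i \<omega> = u i} \<noteq> 0"
      by (auto simp: split split: if_splits)
    have "\<P>(\<omega> in M. S (Suc n) \<omega> = v \<bar> \<forall>i\<le>n. S i \<omega> = u i) = step_prob lam (u n) v"
      using S p unfolding network_random_walk_def by blast
    then show "\<P>(\<omega> in ?N. S (Suc n) \<omega> = v \<bar> \<forall>i\<le>n. S i \<omega> = u i) = step_prob lam (u n) v"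
      unfolding cond_prob_def space_uniform_measure suc split using ua q pos by simp
  qed
qed

lemma independent_network_random_walksI:
  fixes S S' :: "nat \<Rightarrow> 'w \<Rightarrow> ('d::finite) vertex"
  assumes S: "network_random_walk M lam S" and S': "network_random_walk M lam S'"
    and ind: "prob_space.indep_var M path_space (\<lambda>\<omega> n. S n \<omega>) path_space (\<lambda>\<omega> n. S' n \<omega>)"
  shows "independent_network_random_walks M lam S S'"
proof -
  interpret prob_space M using S by (simp add: network_random_walk_def)
  have Sm[measurable]: "\<And>n. S n \<in> measurable M (count_space UNIV)"
    and S'm[measurable]: "\<And>n. S' n \<in> measurable M (count_space UNIV)"
    using S S' by (auto simp: network_random_walk_def)
  note X[measurable] = path_measurable[of S, OF Sm]
  note Y[measurable] = path_measurable[of S', OF S'm]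
  show ?thesis
    unfolding independent_network_random_walks_def Let_def
  proof (intro conjI allI impI prob_space_axioms Sm S'm)
    fix a b assume pos: "prob (start_event M S S' a b) \<noteq> 0"
    let ?E = "start_event M S S' a b"
    let ?N = "uniform_measure M ?E"
    have swap: "start_event M S' S b a = ?E" by auto
    show "network_random_walk ?N lam S"
      by (rule network_random_walk_conditioned[OF S S'm ind pos])
    then have N: "prob_space ?N" by (simp add: network_random_walk_def)
    show "network_random_walk ?N lam S'"
      using network_random_walk_conditioned[OF S' Sm indep_var_commute[OF prob_space_axioms ind], of b a]
        pos unfolding swap by blast
    have epos: "emeasure M ?E \<noteq> 0" using pos by (simp add: emeasure_eq_measure)
    let ?X = "\<lambda>\<omega> n. S n \<omega>" and ?Y = "\<lambda>\<omega> n. S' n \<omega>"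
    let ?a = "{s :: nat \<Rightarrow> 'd vertex. s 0 = a}" and ?b = "{s :: nat \<Rightarrow> 'd vertex. s 0 = b}"
    note sets = start_in_path_space[of a] start_in_path_space[of b]
    have joint: "measure ?N {\<omega>\<in>space M. ?X \<omega> \<in> A \<and> ?Y \<omega> \<in> B} =
        prob {\<omega>\<in>space M. ?X \<omega> \<in> A \<inter> ?a} * prob {\<omega>\<in>space M. ?Y \<omega> \<in> B \<inter> ?b} / prob ?E"
      if A: "A \<in> sets path_space" and B: "B \<in> sets path_space" for A B
    proof -
      have m: "{\<omega>\<in>space M. ?X \<omega> \<in> A \<and> ?Y \<omega> \<in> B} \<in> sets M"
        using A B by measurable
      have "measure ?N {\<omega>\<in>space M. ?X \<omega> \<in> A \<and> ?Y \<omega> \<in> B} =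
          prob (?E \<inter> {\<omega>\<in>space M. ?X \<omega> \<in> A \<and> ?Y \<omega> \<in> B}) / prob ?E"
        by (rule measure_uniform_measure) (use epos m in auto)
      also have "?E \<inter> {\<omega>\<in>space M. ?X \<omega> \<in> A \<and> ?Y \<omega> \<in> B} =
          {\<omega>\<in>space M. ?X \<omega> \<in> A \<inter> ?a \<and> ?Y \<omega> \<in> B \<inter> ?b}" by auto
      also have "prob \<dots> = prob {\<omega>\<in>space M. ?X \<omega> \<in> A \<inter> ?a} * prob {\<omega>\<in>space M. ?Y \<omega> \<in> B \<inter> ?b}"
        using A B sets by (intro indep_var_prod[OF prob_space_axioms ind]) auto
      finally show ?thesis .
    qed
    have top: "UNIV \<in> sets (path_space :: (nat \<Rightarrow> 'd vertex) measure)"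
      using sets.top[of "path_space :: (nat \<Rightarrow> 'd vertex) measure"] by (simp add: space_PiM)
    have E: "prob ?E = prob {\<omega>\<in>space M. ?X \<omega> \<in> ?a} * prob {\<omega>\<in>space M. ?Y \<omega> \<in> ?b}"
      using indep_var_prod[OF prob_space_axioms ind sets] by simp
    show "prob_space.indep_var ?N path_space ?X path_space ?Y"
    proof (rule indep_varI[OF N])
      show "?X \<in> measurable ?N path_space" "?Y \<in> measurable ?N path_space"
        using X Y by (auto simp: measurable_def)
      fix A B :: "(nat \<Rightarrow> 'd vertex) set"
      assume AB: "A \<in> sets path_space" "B \<in> sets path_space"
      show "measure ?N {\<omega>\<in>space ?N. ?X \<omega> \<in> A \<and> ?Y \<omega> \<in> B} =
          measure ?N {\<omega>\<in>space ?N. ?X \<omega> \<in> A} * measure ?N {\<omega>\<in>space ?N. ?Y \<omega> \<in> B}"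
      proof -
        have arith: "x = y * z" if "x = p * q / e" "y = p * s / e" "z = r * q / e" "e = r * s" "e \<noteq> 0"
          for x y z p q r s e :: real
        proof -
          have "y = p / r" "z = q / s" using that by auto
          then show ?thesis using that by simp
        qed
        show ?thesis
          using arith[OF joint[OF AB] _ _ E pos] joint[OF AB(1) top] joint[OF top AB(2)] by simp
      qed
    qed
  qed
qed

end

theory Submission
  imports Defs
begin

text \<open>
  The expected number of crossings is finite.  By independence it is the sum over all vertices of
  the product of the two Green functions.  Because of the upward drift, the level of \<open>S'\<close> is a
  transient walk on the integers, which spends a bounded expected time at every level; hence it
  suffices that the supremum over each level of the Green function of \<open>S\<close> is summable over the
  levels.  Given the numbers \<open>k i\<close> of steps made in the horizontal directions \<open>i\<close>, the coordinates are
  independent, and a horizontal point has probability at most a constant times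
  \<open>\<psi> k = (\<Prod>i. 1 / sqrt (k i + 1))\<close>.  Summing over the levels leaves the expectation of
  the sum of \<open>\<psi>\<close> along the vector of direction counts.  It is finite for \<open>d \<ge> 3\<close>, because
  \<open>(\<Sum>i. k i + 2) * \<psi> k\<close> is a Lyapunov function whose expected decrease in one step is at least
  a positive multiple of \<open>\<psi> k\<close>.
\<close>

section \<open>The one-step operator\<close>

text \<open>The transition operator of the chain. Values in \<open>ennreal\<close> spare every
  integrability condition on the test function \<open>g\<close>.\<close>

definition walk_op :: "real \<Rightarrow> (('d::finite) vertex \<Rightarrow> ennreal) \<Rightarrow> 'd vertex \<Rightarrow> ennreal" where
  "walk_op lam g u = (\<Sum>v | adjacent u v. ennreal (step_prob lam u v) * g v)"

section \<open>Neighbours in the lattice and explicit transition probabilities\<close>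

lemma l1_norm_axis: "(\<Sum>j\<in>UNIV. \<bar>(axis i c :: int ^ 'd::finite) $ j\<bar>) = \<bar>c\<bar>"
proof -
  have "(\<Sum>j\<in>UNIV. \<bar>(axis i c :: int ^ 'd) $ j\<bar>) = (\<Sum>j\<in>UNIV. if j = i then \<bar>c\<bar> else 0)"
    by (intro sum.cong) (auto simp: axis_def)
  then show ?thesis by simp
qed

lemma l1_norm_eq_1_iff:
  fixes y :: "int ^ 'd::finite"
  shows "(\<Sum>j\<in>UNIV. \<bar>y $ j\<bar>) = 1 \<longleftrightarrow> (\<exists>i. y = axis i 1 \<or> y = - axis i 1)"
proof
  assume s: "(\<Sum>j\<in>UNIV. \<bar>y $ j\<bar>) = 1"
  then obtain i where i: "y $ i \<noteq> 0"
    by (metis (no_types, lifting) abs_0 sum.neutral zero_neq_one)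
  have "(\<Sum>j\<in>UNIV. \<bar>y $ j\<bar>) = \<bar>y $ i\<bar> + (\<Sum>j\<in>UNIV - {i}. \<bar>y $ j\<bar>)"
    by (rule sum.remove) auto
  moreover have "(\<Sum>j\<in>UNIV - {i}. \<bar>y $ j\<bar>) \<ge> 0" by (rule sum_nonneg) auto
  ultimately have 1: "\<bar>y $ i\<bar> = 1" and "(\<Sum>j\<in>UNIV - {i}. \<bar>y $ j\<bar>) = 0"
    using s i by linarith+
  then have "y $ j = 0" if "j \<noteq> i" for j
    using that by (subst (asm) sum_nonneg_eq_0_iff) auto
  with 1 have "y = axis i 1 \<or> y = - axis i 1"
    by (auto simp: vec_eq_iff axis_def abs_if split: if_splits)
  then show "\<exists>i. y = axis i 1 \<or> y = - axis i 1" by blast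
next
  show "\<exists>i. y = axis i 1 \<or> y = - axis i 1 \<Longrightarrow> (\<Sum>j\<in>UNIV. \<bar>y $ j\<bar>) = 1"
    using l1_norm_axis[of _ 1] by auto
qed

text \<open>The right-hand side is grouped so that \<open>sum_neighbours\<close> can split a sum
  over it: vertical neighbours first, then for each direction the two horizontal ones.\<close>

lemma neighbours_eq:
  fixes x :: "int ^ 'd::finite"
  shows "{v. adjacent (n, x) v} =
    {(n + 1, x), (n - 1, x)} \<union> (range (\<lambda>i. (n, x + axis i 1)) \<union> range (\<lambda>i. (n, x - axis i 1)))"
proof -
  have "adjacent (n, x) (k, y) \<longleftrightarrow> (\<bar>k - n\<bar> = 1 \<and> y = x) \<or> (k = n \<and> (\<exists>i. y - x = axis i 1 \<or> y - x = - axis i 1))"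
    for k y
  proof -
    let ?s = "\<Sum>j\<in>UNIV. \<bar>(y - x) $ j\<bar>"
    have nn: "?s \<ge> 0" by (rule sum_nonneg) auto
    have z: "?s = 0 \<longleftrightarrow> y = x"
      by (subst sum_nonneg_eq_0_iff) (auto simp: vec_eq_iff)
    have "adjacent (n, x) (k, y) \<longleftrightarrow> \<bar>k - n\<bar> + ?s = 1"
      by (simp add: adjacent_def abs_minus_commute)
    also have "\<dots> \<longleftrightarrow> (\<bar>k - n\<bar> = 1 \<and> ?s = 0) \<or> (k = n \<and> ?s = 1)"
    proof -
      have "\<bar>k - n\<bar> + s = 1 \<longleftrightarrow> (\<bar>k - n\<bar> = 1 \<and> s = 0) \<or> (k = n \<and> s = 1)" if "s \<ge> 0" for s
        using that by arith
      then show ?thesis using nn by blast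
    qed
    finally show ?thesis unfolding z l1_norm_eq_1_iff .
  qed
  note * = this
  have "adjacent (n, x) (k, y) \<longleftrightarrow> (k, y) \<in> {(n + 1, x), (n - 1, x)} \<union> (range (\<lambda>i. (n, x + axis i 1)) \<union> range (\<lambda>i. (n, x - axis i 1)))"
    for k y
    unfolding * by (auto simp: algebra_simps abs_if split: if_splits)
  then show ?thesis by auto
qed

lemma sum_neighbours:
  fixes F :: "('d::finite) vertex \<Rightarrow> 'a::comm_monoid_add"
  shows "(\<Sum>v | adjacent (n, x) v. F v) =
    F (n + 1, x) + F (n - 1, x) + (\<Sum>i\<in>UNIV. F (n, x + axis i 1) + F (n, x - axis i 1))"
proof -
  have inj: "inj (\<lambda>i. (n, x + axis i 1))" "inj (\<lambda>i. (n, x - axis i 1))"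
    by (auto intro!: injI simp: axis_eq_axis)
  have disj: "range (\<lambda>i. (n, x + axis i 1)) \<inter> range (\<lambda>i. (n, x - axis i 1)) = {}"
  proof -
    have False if "axis i 1 = - (axis j 1 :: int ^ 'd)" for i j
    proof -
      have "(axis i 1 :: int ^ 'd) $ i = - (axis j 1 :: int ^ 'd) $ i" using that by simp
      then show False by (auto simp: axis_def split: if_splits)
    qed
    then show ?thesis by (auto simp: algebra_simps eq_neg_iff_add_eq_0)
  qed
  have "sum F (range (\<lambda>i. (n, x + axis i 1)) \<union> range (\<lambda>i. (n, x - axis i 1))) =
      (\<Sum>i\<in>UNIV. F (n, x + axis i 1) + F (n, x - axis i 1))"
    using sum.union_disjoint[OF _ _ disj, of F] by (simp add: sum.reindex inj sum.distrib)
  moreover have "sum F {(n + 1, x), (n - 1, x)} = F (n + 1, x) + F (n - 1, x)" by simp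
  ultimately show ?thesis
    unfolding neighbours_eq by (subst sum.union_disjoint) auto
qed

text \<open>The conductances at a vertex of level \<open>n\<close> add up to
  \<open>exp (lam * n)\<close> times this number. The dimension enters through the
  \<open>itself\<close> argument, since no other argument mentions the type
  \<open>'d\<close>.\<close>

definition total_weight :: "real \<Rightarrow> 'd::finite itself \<Rightarrow> real" where
  "total_weight lam _ = exp lam + 1 + 2 * real CARD('d)"

lemma total_weight_pos: "total_weight lam TYPE('d::finite) > 0"
  unfolding total_weight_def using exp_gt_zero[of lam] by (smt (verit) of_nat_0_le_iff)

text \<open>The common factor \<open>exp (lam * n)\<close> cancels in every transition probability,
  so the step distribution is the same at all vertices.\<close>

lemma walk_op_eq:
  fixes lam :: real and g :: "('d::finite) vertex \<Rightarrow> ennreal"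
  defines "Z \<equiv> total_weight lam TYPE('d)"
  shows "walk_op lam g (n, x) = ennreal (exp lam / Z) * g (n + 1, x) + ennreal (1 / Z) * g (n - 1, x)
     + (\<Sum>i\<in>UNIV. ennreal (1 / Z) * (g (n, x + axis i 1) + g (n, x - axis i 1)))"
proof -
  have adj: "adjacent (n, x) (n + 1, x)" "adjacent (n, x) (n - 1, x)"
     "adjacent (n, x) (n, x + axis i 1)" "adjacent (n, x) (n, x - axis i 1)" for i
    using neighbours_eq[of n x] by (auto simp: set_eq_iff)
  have e: "exp (lam * (real_of_int n + 1)) = exp (lam * n) * exp lam"
    by (simp add: algebra_simps exp_add)
  \<comment> \<open>Only the upward edge has a higher endpoint than \<open>n\<close>, whence its
    additional factor \<open>exp lam\<close>.\<close>
  have c: "conductance lam (n, x) (n + 1, x) = exp (lam * n) * exp lam" 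
     "conductance lam (n, x) (n - 1, x) = exp (lam * n)"
     "conductance lam (n, x) (n, x + axis i 1) = exp (lam * n)"
     "conductance lam (n, x) (n, x - axis i 1) = exp (lam * n)" for i
    by (simp_all add: conductance_def adj e max_def)
  have tot: "(\<Sum>w | adjacent (n, x) w. conductance lam (n, x) w) = exp (lam * n) * Z"
    unfolding sum_neighbours c Z_def total_weight_def by (simp add: algebra_simps)
  have s: "step_prob lam (n, x) (n + 1, x) = exp lam / Z" 
     "step_prob lam (n, x) (n - 1, x) = 1 / Z"
     "step_prob lam (n, x) (n, x + axis i 1) = 1 / Z"
     "step_prob lam (n, x) (n, x - axis i 1) = 1 / Z" for i
    by (simp_all add: step_prob_def tot c)
  show ?thesis
    unfolding walk_op_def sum_neighbours s by (simp add: distrib_left)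
qed

text \<open>The Markov property in integrated form. Walks are defined by conditioning on the whole
  past, so the integral is decomposed over all histories up to time \<open>m\<close>; on each of
  them the transition depends on the last entry alone.\<close>

lemma nn_integral_walk_Suc:
  fixes S :: "nat \<Rightarrow> 'w \<Rightarrow> ('d::finite) vertex"
  assumes S: "network_random_walk N lam S"
  shows "(\<integral>\<^sup>+\<omega>. g (S (Suc m) \<omega>) \<partial>N) = (\<integral>\<^sup>+\<omega>. walk_op lam g (S m \<omega>) \<partial>N)"
proof -
  interpret prob_space N using S by (simp add: network_random_walk_def)
  have Sm[measurable]: "S n \<in> measurable N (count_space UNIV)" for n
    using S by (simp add: network_random_walk_def)
  \<comment> \<open>Histories are lists, of which there are countably many, so sums over them may be
    exchanged with integrals.\<close>
  define H where "H \<omega> = map (\<lambda>i. S i \<omega>) [0..<Suc m]" for \<omega>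
  have H_eq: "H \<omega> = h \<longleftrightarrow> length h = Suc m \<and> (\<forall>i\<le>m. S i \<omega> = h ! i)" for \<omega> h
    by (auto simp: H_def list_eq_iff_nth_eq less_Suc_eq_le simp del: upt_Suc)
  have Hset[measurable]: "Measurable.pred N (\<lambda>\<omega>. H \<omega> = h)" for h
    unfolding H_eq by measurable
  have gm[measurable]: "(\<lambda>\<omega>. f (S n \<omega>)) \<in> borel_measurable N" for f :: "_ \<Rightarrow> ennreal" and n
    by (rule measurable_compose[OF Sm]) simp
  \<comment> \<open>The conditional probability is prescribed only for histories of positive
    probability; for the others both sides are zero.\<close>
  have trans: "emeasure N {\<omega>\<in>space N. H \<omega> = h \<and> S (Suc m) \<omega> = v} =
      ennreal (step_prob lam (h ! m) v) * emeasure N {\<omega>\<in>space N. H \<omega> = h}" for h v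
  proof (cases "length h = Suc m \<and> prob {\<omega>\<in>space N. H \<omega> = h} \<noteq> 0")
    case True
    then have Hh: "H \<omega> = h \<longleftrightarrow> (\<forall>i\<le>m. S i \<omega> = h ! i)" for \<omega>
      by (simp add: H_eq)
    then have h: "\<P>(\<omega> in N. \<forall>i\<le>m. S i \<omega> = h ! i) \<noteq> 0" using True by simp
    then have "\<P>(\<omega> in N. S (Suc m) \<omega> = v \<bar> \<forall>i\<le>m. S i \<omega> = h ! i) = step_prob lam (h ! m) v"
      using S unfolding network_random_walk_def by blast
    then have "prob {\<omega>\<in>space N. H \<omega> = h \<and> S (Suc m) \<omega> = v} =
        step_prob lam (h ! m) v * prob {\<omega>\<in>space N. H \<omega> = h}"
      using h unfolding cond_prob_def Hh by (simp add: field_simps conj_commute)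
    then show ?thesis
      by (simp add: emeasure_eq_measure ennreal_mult'')
  next
    case False
    then have "emeasure N {\<omega>\<in>space N. H \<omega> = h} = 0"
      by (auto simp: emeasure_eq_measure) (auto simp: H_eq)
    moreover have "emeasure N {\<omega>\<in>space N. H \<omega> = h \<and> S (Suc m) \<omega> = v} \<le> emeasure N {\<omega>\<in>space N. H \<omega> = h}"
      by (rule emeasure_mono) auto
    ultimately show ?thesis by simp
  qed
  have last: "H \<omega> ! m = S m \<omega>" for \<omega>
    by (simp add: H_def nth_append)
  have split: "(\<integral>\<^sup>+\<omega>. f \<omega> \<partial>N) = (\<integral>\<^sup>+h. (\<integral>\<^sup>+\<omega>. f \<omega> * indicator {\<omega>. H \<omega> = h} \<omega> \<partial>N) \<partial>count_space UNIV)"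
    if [measurable]: "f \<in> borel_measurable N" for f
  proof -
    have "(\<integral>\<^sup>+\<omega>. f \<omega> \<partial>N) = (\<integral>\<^sup>+\<omega>. (\<integral>\<^sup>+h. f \<omega> * indicator {\<omega>. H \<omega> = h} \<omega> \<partial>count_space UNIV) \<partial>N)"
    proof (intro nn_integral_cong)
      fix \<omega>
      have "(\<integral>\<^sup>+h. f \<omega> * indicator {\<omega>. H \<omega> = h} \<omega> \<partial>count_space UNIV) = (\<integral>\<^sup>+h. f \<omega> * indicator {H \<omega>} h \<partial>count_space UNIV)"
        by (intro nn_integral_cong) (auto split: split_indicator)
      then show "f \<omega> = (\<integral>\<^sup>+h. f \<omega> * indicator {\<omega>. H \<omega> = h} \<omega> \<partial>count_space UNIV)" by simp
    qed
    also have "\<dots> = (\<integral>\<^sup>+h. (\<integral>\<^sup>+\<omega>. f \<omega> * indicator {\<omega>. H \<omega> = h} \<omega> \<partial>N) \<partial>count_space UNIV)"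
      by (rule nn_integral_count_space_nn_integral) auto
    finally show ?thesis .
  qed
  have inner: "(\<integral>\<^sup>+\<omega>. g (S (Suc m) \<omega>) * indicator {\<omega>. H \<omega> = h} \<omega> \<partial>N) =
     (\<integral>\<^sup>+\<omega>. walk_op lam g (S m \<omega>) * indicator {\<omega>. H \<omega> = h} \<omega> \<partial>N)" for h
  proof -
    have "(\<integral>\<^sup>+\<omega>. g (S (Suc m) \<omega>) * indicator {\<omega>. H \<omega> = h} \<omega> \<partial>N) =
        (\<integral>\<^sup>+\<omega>. (\<integral>\<^sup>+v. g v * indicator {\<omega>. H \<omega> = h \<and> S (Suc m) \<omega> = v} \<omega> \<partial>count_space UNIV) \<partial>N)"
    proof (intro nn_integral_cong)
      fix \<omega>
      have "(\<integral>\<^sup>+v. g v * indicator {\<omega>. H \<omega> = h \<and> S (Suc m) \<omega> = v} \<omega> \<partial>count_space UNIV) =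
         (\<integral>\<^sup>+v. (g (S (Suc m) \<omega>) * indicator {\<omega>. H \<omega> = h} \<omega>) * indicator {S (Suc m) \<omega>} v \<partial>count_space UNIV)"
        by (intro nn_integral_cong) (auto split: split_indicator)
      then show "g (S (Suc m) \<omega>) * indicator {\<omega>. H \<omega> = h} \<omega> =
          (\<integral>\<^sup>+v. g v * indicator {\<omega>. H \<omega> = h \<and> S (Suc m) \<omega> = v} \<omega> \<partial>count_space UNIV)" by simp
    qed
    also have "\<dots> = (\<integral>\<^sup>+v. (\<integral>\<^sup>+\<omega>. g v * indicator {\<omega>. H \<omega> = h \<and> S (Suc m) \<omega> = v} \<omega> \<partial>N) \<partial>count_space UNIV)"
      by (rule nn_integral_count_space_nn_integral) auto
    also have "\<dots> = (\<integral>\<^sup>+v. g v * emeasure N {\<omega>\<in>space N. H \<omega> = h \<and> S (Suc m) \<omega> = v} \<partial>count_space UNIV)"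
    proof (intro nn_integral_cong)
      fix v
      have "(\<integral>\<^sup>+\<omega>. g v * indicator {\<omega>. H \<omega> = h \<and> S (Suc m) \<omega> = v} \<omega> \<partial>N) =
        (\<integral>\<^sup>+\<omega>. g v * indicator {\<omega>\<in>space N. H \<omega> = h \<and> S (Suc m) \<omega> = v} \<omega> \<partial>N)"
        by (intro nn_integral_cong) (auto split: split_indicator)
      then show "(\<integral>\<^sup>+\<omega>. g v * indicator {\<omega>. H \<omega> = h \<and> S (Suc m) \<omega> = v} \<omega> \<partial>N) =
        g v * emeasure N {\<omega>\<in>space N. H \<omega> = h \<and> S (Suc m) \<omega> = v}"
        by (simp add: nn_integral_cmult)
    qed
    also have "\<dots> = (\<integral>\<^sup>+v. (ennreal (step_prob lam (h ! m) v) * g v) * emeasure N {\<omega>\<in>space N. H \<omega> = h} \<partial>count_space UNIV)"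
      unfolding trans by (simp add: mult_ac)
    also have "\<dots> = (\<integral>\<^sup>+v. (ennreal (step_prob lam (h ! m) v) * g v) \<partial>count_space UNIV) * emeasure N {\<omega>\<in>space N. H \<omega> = h}"
      by (rule nn_integral_multc) simp
    also have "(\<integral>\<^sup>+v. (ennreal (step_prob lam (h ! m) v) * g v) \<partial>count_space UNIV) = walk_op lam g (h ! m)"
      unfolding walk_op_def
      by (rule nn_integral_count_space'[OF finite_neighbours])
         (auto simp: step_prob_def conductance_def)
    also have "walk_op lam g (h ! m) * emeasure N {\<omega>\<in>space N. H \<omega> = h} =
        (\<integral>\<^sup>+\<omega>. walk_op lam g (h ! m) * indicator {\<omega>\<in>space N. H \<omega> = h} \<omega> \<partial>N)"
      by (simp add: nn_integral_cmult)
    also have "\<dots> = (\<integral>\<^sup>+\<omega>. walk_op lam g (S m \<omega>) * indicator {\<omega>. H \<omega> = h} \<omega> \<partial>N)"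
      by (intro nn_integral_cong) (auto simp: last split: split_indicator)
    finally show ?thesis .
  qed
  show ?thesis
    using split[of "\<lambda>\<omega>. g (S (Suc m) \<omega>)"] split[of "\<lambda>\<omega>. walk_op lam g (S m \<omega>)"] inner by simp
qed

section \<open>Simple random walk on the integers\<close>

text \<open>The probability that simple random walk on the integers has displacement
  \<open>x\<close> after \<open>k\<close> steps.\<close>

fun srw_kernel :: "nat \<Rightarrow> int \<Rightarrow> real" where
  "srw_kernel 0 x = (if x = 0 then 1 else 0)"
| "srw_kernel (Suc k) x = (srw_kernel k (x + 1) + srw_kernel k (x - 1)) / 2"

lemma srw_kernel_nonneg [simp]: "0 \<le> srw_kernel k x"
  by (induction k arbitrary: x) auto

lemma srw_kernel_off: "(\<And>i::nat. x \<noteq> 2 * int i - int k) \<Longrightarrow> srw_kernel k x = 0"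
proof (induction k arbitrary: x)
  case 0
  then show ?case using "0.prems"[of 0] by simp
next
  case (Suc k)
  have "x + 1 \<noteq> 2 * int i - int k" for i using Suc.prems[of i] by simp
  moreover have "x - 1 \<noteq> 2 * int i - int k" for i using Suc.prems[of "Suc i"] by simp
  ultimately show ?case using Suc.IH by simp
qed

lemma srw_kernel_binomial: "srw_kernel k (2 * int i - int k) = real (k choose i) / 2 ^ k"
proof (induction k arbitrary: i)
  case 0
  then show ?case by (cases i) auto
next
  case (Suc k)
  have up: "srw_kernel k (2 * int i - int (Suc k) + 1) = real (k choose i) / 2 ^ k"
    using Suc.IH[of i] by (simp add: algebra_simps)
  show ?case
  proof (cases i)
    case 0
    have "srw_kernel k (2 * int i - int (Suc k) - 1) = 0"
      by (rule srw_kernel_off) (use 0 in auto)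
    then show ?thesis using up 0 by simp
  next
    case (Suc j)
    have "srw_kernel k (2 * int i - int (Suc k) - 1) = real (k choose j) / 2 ^ k"
      using Suc.IH[of j] Suc by (simp add: algebra_simps)
    then show ?thesis using up Suc by (simp add: field_simps)
  qed
qed

text \<open>The ratio of consecutive normalised central coefficients is
  \<open>(2j+1)/(2j+2)\<close>, and \<open>(2j+1)(2j+3) \<le> (2j+2)^2\<close> carries the bound
  through the induction. Squaring keeps square roots out of it.\<close>

lemma central_binomial_upper: "(real ((2 * j) choose j) / 2 ^ (2 * j))\<^sup>2 * (2 * real j + 1) \<le> 1"
proof (induction j)
  case (Suc j)
  let ?c = "\<lambda>j. real ((2 * j) choose j) / 2 ^ (2 * j)"
  have "Suc j * (2 * Suc j choose Suc j) = 2 * (Suc (2 * j)) * (2 * j choose j)"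
  proof -
    have "Suc j * (2 * Suc j choose Suc j) = (2 * Suc j) * (Suc (2 * j) choose j)"
      using Suc_times_binomial_eq[of "Suc (2*j)" j] by simp
    moreover have "Suc j * (Suc (2 * j) choose j) = Suc (2 * j) * (2 * j choose j)"
      using binomial_absorb_comp[of "Suc (2*j)" j] by (simp add: algebra_simps)
    ultimately have "Suc j * (Suc j * (2 * Suc j choose Suc j)) = Suc j * (2 * (Suc (2 * j)) * (2 * j choose j))"
      by (metis mult.assoc mult.commute)
    then show ?thesis by (simp only: mult_cancel1) simp
  qed
  then have "real (Suc j) * real (2 * Suc j choose Suc j) = real (2 * (Suc (2 * j))) * real (2 * j choose j)"
    by (metis of_nat_mult)
  then have "real (2 * Suc j choose Suc j) = 2 * (2 * real j + 1) * real (2 * j choose j) / (real j + 1)"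
    by (simp add: field_simps)
  then have c: "?c (Suc j) = ?c j * ((2 * real j + 1) / (2 * real j + 2))"
    by (simp add: divide_simps del: binomial_Suc_Suc) (simp add: algebra_simps del: binomial_Suc_Suc)
  have "(2 * real j + 1) * (2 * real j + 3) \<le> (2 * real j + 2)\<^sup>2"
    by (simp add: power2_eq_square algebra_simps)
  then have "(2 * real j + 1) * (2 * real j + 3) / (2 * real j + 2)\<^sup>2 \<le> 1"
    by simp
  then have "((?c j)\<^sup>2 * (2 * real j + 1)) * ((2 * real j + 1) * (2 * real j + 3) / (2 * real j + 2)\<^sup>2) \<le> 1 * 1"
    by (intro mult_mono Suc.IH) auto
  also have "((?c j)\<^sup>2 * (2 * real j + 1)) * ((2 * real j + 1) * (2 * real j + 3) / (2 * real j + 2)\<^sup>2)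
     = (?c (Suc j))\<^sup>2 * (2 * real (Suc j) + 1)"
  proof -
    have "2 * real (Suc j) + 1 = 2 * real j + 3" by simp
    then show ?thesis
      unfolding c power_mult_distrib power_divide by (simp only:) (simp add: power2_eq_square)
  qed
  finally show ?case by simp
qed simp

text \<open>At even times the central binomial coefficient is the largest. At odd times the kernel
  is an average of two values at the preceding even time, which costs at most the factor
  \<open>sqrt 2\<close>.\<close>

lemma srw_kernel_bound: "srw_kernel k x \<le> sqrt 2 / sqrt (real (Suc k))"
proof (induction k arbitrary: x rule: less_induct)
  case (less k)
  have even_case: "srw_kernel (2 * j) x \<le> 1 / sqrt (real (Suc (2 * j)))" for j x
  proof (cases "\<exists>i::nat. x = 2 * int i - int (2 * j)")
    case True
    then obtain i :: nat where "x = 2 * int i - int (2 * j)" by blast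
    then have "srw_kernel (2 * j) x = real (2 * j choose i) / 2 ^ (2 * j)"
      using srw_kernel_binomial by metis
    also have "\<dots> \<le> real (2 * j choose j) / 2 ^ (2 * j)"
      using binomial_maximum'[of j i] by (intro divide_right_mono) auto
    also have "\<dots> \<le> 1 / sqrt (real (Suc (2 * j)))"
    proof -
      have "(real (2 * j choose j) / 2 ^ (2 * j))\<^sup>2 \<le> 1 / real (Suc (2 * j))"
        using central_binomial_upper[of j] by (subst pos_le_divide_eq) (auto simp: add.commute)
      then have "real (2 * j choose j) / 2 ^ (2 * j) \<le> sqrt (1 / real (Suc (2 * j)))"
        by (rule real_le_rsqrt)
      then show ?thesis by (simp only: real_sqrt_divide real_sqrt_one)
    qed
    finally show ?thesis .
  next
    case False
    then have "srw_kernel (2 * j) x = 0" by (intro srw_kernel_off) auto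
    then show ?thesis by simp
  qed
  show ?case
  proof (cases "even k")
    case True
    then obtain j where j: "k = 2 * j" by blast
    have "srw_kernel k x \<le> 1 / sqrt (real (Suc k))" using even_case[of j x] j by simp
    also have "\<dots> \<le> sqrt 2 / sqrt (real (Suc k))" by (intro divide_right_mono) auto
    finally show ?thesis .
  next
    case False
    then obtain j where j: "k = Suc (2 * j)" using oddE by fastforce
    have "srw_kernel k x \<le> 1 / sqrt (real (Suc (2 * j)))"
      using even_case[of j "x + 1"] even_case[of j "x - 1"] unfolding j by simp
    also have "\<dots> = sqrt 2 / sqrt (2 * real (Suc (2 * j)))"
    proof -
      have "1 / sqrt y = sqrt 2 / sqrt (2 * y)" for y by (simp add: real_sqrt_mult)
      then show ?thesis .
    qed
    \<comment> \<open>Here \<open>Suc k = 2j + 2\<close>, which is at most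
      \<open>2 * (2j + 1)\<close>.\<close>
    also have "\<dots> \<le> sqrt 2 / sqrt (real (Suc k))"
      using j by (intro divide_left_mono) auto
    finally show ?thesis .
  qed
qed

section \<open>The Lyapunov function\<close>

text \<open>The function \<psi> of the overview; adding 1 under each root keeps the factor finite
  when \<open>k i = 0\<close>.\<close>

definition decay :: "('d::finite \<Rightarrow> nat) \<Rightarrow> real" where
  "decay k = (\<Prod>i\<in>UNIV. 1 / sqrt (real (Suc (k i))))"

text \<open>The summands are shifted by 2 to match the denominators \<open>k i + 2\<close> in
  \<open>decay_Suc_le\<close>, so that the arithmetic-harmonic mean inequality applies to exactly
  this sum.\<close>

definition lyapunov :: "('d::finite \<Rightarrow> nat) \<Rightarrow> real" where
  "lyapunov k = (\<Sum>i\<in>UNIV. real (k i) + 2) * decay k"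

lemma decay_nonneg [simp]: "0 \<le> decay k"
  unfolding decay_def by (intro prod_nonneg) auto

lemma lyapunov_nonneg [simp]: "0 \<le> lyapunov k"
  unfolding lyapunov_def by (intro mult_nonneg_nonneg sum_nonneg) auto

text \<open>Only the factor of index \<open>i\<close> changes. With \<open>a = k i\<close> its ratio
  is \<open>sqrt (1 - 1/(a+2))\<close>, and \<open>1 - 2u \<le> (1 - u)^2\<close> with
  \<open>u = 1/(2(a+2))\<close> linearises the root.\<close>

lemma decay_Suc_le:
  "decay (k(i := Suc (k i))) \<le> decay k * (1 - 1 / (2 * (real (k i) + 2)))"
proof -
  let ?r = "\<Prod>j\<in>UNIV - {i}. 1 / sqrt (real (Suc (k j)))"
  let ?a = "real (k i)"
  have k: "decay k = 1 / sqrt (?a + 1) * ?r"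
    unfolding decay_def by (subst prod.remove[of _ i]) (auto simp: add.commute)
  have "decay (k(i := Suc (k i))) = 1 / sqrt (?a + 2) *
      (\<Prod>j\<in>UNIV - {i}. 1 / sqrt (real (Suc ((k(i := Suc (k i))) j))))"
    unfolding decay_def by (subst prod.remove[of _ i]) (auto simp: add.commute)
  also have "(\<Prod>j\<in>UNIV - {i}. 1 / sqrt (real (Suc ((k(i := Suc (k i))) j)))) = ?r"
    by (intro prod.cong) auto
  finally have k': "decay (k(i := Suc (k i))) = 1 / sqrt (?a + 2) * ?r" .
  have r: "?r \<ge> 0" by (intro prod_nonneg) auto
  have "sqrt ((?a + 1) / (?a + 2)) \<le> sqrt ((1 - 1 / (2 * (?a + 2)))\<^sup>2)"
  proof (intro real_sqrt_le_mono)
    have "(?a + 1) / (?a + 2) = 1 - 1 / (?a + 2)" by (simp add: field_simps)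
    also have "\<dots> \<le> (1 - 1 / (2 * (?a + 2)))\<^sup>2"
    proof -
      have "1 - 2 * u \<le> (1 - u)\<^sup>2" for u :: real by (simp add: power2_eq_square algebra_simps)
      moreover have "1 / (?a + 2) = 2 * (1 / (2 * (?a + 2)))" by (simp add: divide_simps)
      ultimately show ?thesis by (simp only:)
    qed
    finally show "(?a + 1) / (?a + 2) \<le> (1 - 1 / (2 * (?a + 2)))\<^sup>2" .
  qed
  also have "\<dots> = 1 - 1 / (2 * (?a + 2))" by simp
  finally have *: "sqrt ((?a + 1) / (?a + 2)) \<le> 1 - 1 / (2 * (?a + 2))" .
  have "1 / sqrt (?a + 2) \<le> 1 / sqrt (?a + 1) * (1 - 1 / (2 * (?a + 2)))"
  proof -
    have "1 / q \<le> 1 / p * y" if "p / q \<le> y" "p > 0" for p q y :: real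
      using divide_right_mono[OF that(1), of p] that(2) by simp
    then show ?thesis using * by (simp only: real_sqrt_divide) simp
  qed
  then have "1 / sqrt (?a + 2) * ?r \<le> 1 / sqrt (?a + 1) * (1 - 1 / (2 * (?a + 2))) * ?r"
    using r by (intro mult_right_mono)
  then show ?thesis unfolding k k' by (simp add: mult_ac)
qed

text \<open>For \<open>d \<ge> 3\<close> the coefficient \<open>d\<^sup>2 / 2 - d\<close> is positive: this is where the dimension enters.\<close>

lemma lyapunov_drift:
  fixes k :: "'d::finite \<Rightarrow> nat"
  defines "d \<equiv> real CARD('d)"
  shows "(\<Sum>i\<in>UNIV. lyapunov (k(i := Suc (k i)))) + (d\<^sup>2 / 2 - d) * decay k \<le> d * lyapunov k"
proof -
  define N where "N = (\<Sum>i\<in>UNIV. real (k i) + 2)"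
  have d: "d > 0" unfolding d_def by simp
  have "N \<ge> (\<Sum>i\<in>(UNIV::'d set). 2)" unfolding N_def by (intro sum_mono) auto
  then have "N \<ge> 2 * d" by (simp add: d_def)
  then have N: "N > 0" using d by linarith
  \<comment> \<open>The linear factor grows by 1 whichever direction is incremented; only
    \<open>decay\<close> depends on the direction.\<close>
  have N_Suc: "(\<Sum>j\<in>UNIV. real ((k(i := Suc (k i))) j) + 2) = N + 1" for i
  proof -
    have "(\<Sum>j\<in>UNIV. real ((k(i := Suc (k i))) j) + 2) = (\<Sum>j\<in>UNIV. (real (k j) + 2) + (if j = i then 1 else 0))"
      by (intro sum.cong) auto
    then show ?thesis by (simp add: sum.distrib N_def)
  qed
  \<comment> \<open>arithmetic and harmonic means, via the tangent line of \<open>1/x\<close> at \<open>N/d\<close>\<close>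
  have "(\<Sum>i\<in>UNIV. 1 / (real (k i) + 2)) \<ge> (\<Sum>i\<in>UNIV. 2 * d / N - (real (k i) + 2) * (d / N)\<^sup>2)"
  proof (intro sum_mono)
    fix i
    let ?a = "real (k i) + 2"
    have "0 \<le> (?a * (d / N) - 1)\<^sup>2 / ?a" by simp
    also have "\<dots> = ?a * (d / N)\<^sup>2 - 2 * (d / N) + 1 / ?a"
    proof -
      have "(a * q - 1)\<^sup>2 / a = a * q\<^sup>2 - 2 * q + 1 / a" if "a > 0" for a q :: real
        using that by (simp add: power2_eq_square field_simps)
      from this[of ?a "d / N"] show ?thesis by (simp only:)
    qed
    finally show "2 * d / N - ?a * (d / N)\<^sup>2 \<le> 1 / ?a" by simp
  qed
  also have "(\<Sum>i\<in>UNIV. 2 * d / N - (real (k i) + 2) * (d / N)\<^sup>2) = d * (2 * d / N) - N * (d / N)\<^sup>2"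
    unfolding sum_subtractf sum_distrib_right[symmetric] N_def[symmetric] by (simp add: d_def)
  also have "\<dots> = d\<^sup>2 / N" using N by (simp add: power2_eq_square field_simps)
  finally have hm: "d\<^sup>2 / N \<le> (\<Sum>i\<in>UNIV. 1 / (real (k i) + 2))" .
  have "(\<Sum>i\<in>UNIV. lyapunov (k(i := Suc (k i)))) = (N + 1) * (\<Sum>i\<in>UNIV. decay (k(i := Suc (k i))))"
    unfolding lyapunov_def N_Suc sum_distrib_left ..
  also have "\<dots> \<le> (N + 1) * (\<Sum>i\<in>UNIV. decay k * (1 - 1 / (2 * (real (k i) + 2))))"
    using N by (intro mult_left_mono sum_mono decay_Suc_le) auto
  also have "(\<Sum>i\<in>UNIV. decay k * (1 - 1 / (2 * (real (k i) + 2)))) = decay k * (d - (\<Sum>i\<in>UNIV. 1 / (real (k i) + 2)) / 2)"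
    unfolding sum_distrib_left[symmetric] sum_subtractf sum_divide_distrib by (simp add: d_def mult.commute)
  also have "(N + 1) * (decay k * (d - (\<Sum>i\<in>UNIV. 1 / (real (k i) + 2)) / 2)) \<le> (N + 1) * (decay k * (d - d\<^sup>2 / N / 2))"
    using hm N by (intro mult_left_mono) auto
  \<comment> \<open>Expanding \<open>(N + 1) * (d - d^2/(2N))\<close> leaves, besides
    \<open>d * N\<close>, a gain \<open>d\<close> from the larger linear factor against a loss
    \<open>d^2/2\<close> from the decay; the remaining loss \<open>d^2/(2N)\<close> is dropped
    next.\<close>
  also have "\<dots> = d * (N * decay k) - (d\<^sup>2 / 2 - d) * decay k - d\<^sup>2 / N / 2 * decay k"
    using N by (simp add: field_simps)
  also have "\<dots> \<le> d * (N * decay k) - (d\<^sup>2 / 2 - d) * decay k"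
    using N by simp
  finally show ?thesis unfolding lyapunov_def N_def[symmetric] by simp
qed

section \<open>Time spent on a level\<close>

text \<open>The function \<open>exp (- lam * fst v)\<close> is harmonic, so truncating it at level \<open>n\<close> yields a bounded
  superharmonic function whose Laplacian is supported on that level.\<close>

lemma vertical_potential:
  fixes lam :: real and n :: int and u :: "('d::finite) vertex"
  assumes lam: "lam > 0"
  defines "Z \<equiv> total_weight lam TYPE('d)"
    and "h \<equiv> \<lambda>v :: 'd vertex. ennreal (min 1 (exp (- lam * (fst v - n))))"
  shows "ennreal ((exp lam - 1) / Z) * indicator {v. fst v = n} u + walk_op lam h u \<le> h u"
proof -
  obtain k x where u: "u = (k, x)" by (cases u)
  define H where "H j = min 1 (exp (- lam * (real_of_int j - n)))" for j :: int
  have Z: "Z > 0" unfolding Z_def by (rule total_weight_pos)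
  have Z': "Z = exp lam + 1 + 2 * real CARD('d)" by (simp add: Z_def total_weight_def)
  have H0: "H j \<ge> 0" for j by (simp add: H_def)
  have H_le: "H j = 1" if "j \<le> n" for j using that lam by (auto simp: H_def min_def mult_le_0_iff)
  have H_gt: "H j = exp (- lam * (real_of_int j - n))" if "j \<ge> n" for j
  proof -
    have "lam * (real_of_int j - n) \<ge> 0" using that lam by simp
    then show ?thesis by (simp add: H_def)
  qed
  \<comment> \<open>This is the claim multiplied by \<open>Z\<close>, without the horizontal steps,
    which leave \<open>H k\<close> unchanged. Equality holds in all three cases: \<open>H\<close> is
    constant below level \<open>n\<close> and harmonic above it, and the truncation at level
    \<open>n\<close> creates the defect \<open>exp lam - 1\<close>.\<close>
  have main: "(exp lam - 1) * (if k = n then 1 else 0) + exp lam * H (k + 1) + H (k - 1) \<le> (exp lam + 1) * H k"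
  proof -
    consider "k < n" | "k = n" | "k > n" by linarith
    then show ?thesis
    proof cases
      case 1 then show ?thesis by (simp add: H_le)
    next
      case 2
      have "exp lam * H (n + 1) = 1"
        by (subst H_gt) (auto simp: exp_minus)
      then show ?thesis using 2 by (simp add: H_le)
    next
      case 3
      have "exp lam * H (k + 1) = H k"
        using 3 by (simp add: H_gt flip: exp_add) (simp add: algebra_simps)
      moreover have "H (k - 1) = exp lam * H k"
        using 3 by (simp add: H_gt flip: exp_add) (simp add: algebra_simps)
      ultimately show ?thesis using 3 by (simp add: algebra_simps)
    qed
  qed
  have "walk_op lam h u = ennreal (exp lam / Z) * ennreal (H (k + 1)) + ennreal (1 / Z) * ennreal (H (k - 1)) +
      (\<Sum>i\<in>(UNIV :: 'd set). ennreal (1 / Z) * (ennreal (H k) + ennreal (H k)))"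
    unfolding u walk_op_eq Z_def h_def H_def by simp
  also have "\<dots> = ennreal (exp lam / Z * H (k + 1) + 1 / Z * H (k - 1) + (\<Sum>i\<in>(UNIV :: 'd set). 1 / Z * (H k + H k)))"
    using Z H0 by (simp add: sum_nonneg sum_ennreal flip: ennreal_mult ennreal_plus del: sum_constant)
  finally have w: "walk_op lam h u = \<dots>" .
  have "ennreal ((exp lam - 1) / Z) * indicator {v. fst v = n} u = ennreal ((exp lam - 1) / Z * (if k = n then 1 else 0))"
    by (simp add: u)
  then have "ennreal ((exp lam - 1) / Z) * indicator {v. fst v = n} u + walk_op lam h u
     = ennreal ((exp lam - 1) / Z * (if k = n then 1 else 0) +
        (exp lam / Z * H (k + 1) + 1 / Z * H (k - 1) + (\<Sum>i\<in>(UNIV :: 'd set). 1 / Z * (H k + H k))))"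
    unfolding w using Z H0 lam by (subst ennreal_plus) (auto intro!: add_nonneg_nonneg sum_nonneg)
  also have "\<dots> = ennreal (((exp lam - 1) * (if k = n then 1 else 0) + exp lam * H (k + 1) + H (k - 1) + 2 * real CARD('d) * H k) / Z)"
    by (simp add: add_divide_distrib mult_ac add_ac)
  also have "\<dots> \<le> ennreal ((exp lam + 1) * H k / Z + 2 * real CARD('d) * H k / Z)"
    unfolding add_divide_distrib[symmetric] using main Z by (intro ennreal_leI divide_right_mono) auto
  also have "(exp lam + 1) * H k / Z + 2 * real CARD('d) * H k / Z = H k * Z / Z"
    unfolding add_divide_distrib[symmetric] by (simp add: Z' algebra_simps)
  also have "ennreal \<dots> = h u" using Z by (simp add: h_def H_def u)
  finally show ?thesis .
qed

text \<open>Every visit to level \<open>n\<close> uses up the amount \<open>c\<close> of the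
  expected potential \<open>h\<close>, which lies between 0 and 1. Hence the expected number of
  visits is at most \<open>1 / c\<close>, whatever the level and the initial law.\<close>

lemma vertical_green_bound:
  fixes S :: "nat \<Rightarrow> 'w \<Rightarrow> ('d::finite) vertex"
  assumes lam: "lam > 0" and S: "network_random_walk N lam S"
  shows "(\<Sum>m. emeasure N {\<omega>\<in>space N. fst (S m \<omega>) = n}) \<le> ennreal (total_weight lam TYPE('d) / (exp lam - 1))"
proof -
  interpret prob_space N using S by (simp add: network_random_walk_def)
  have Sm[measurable]: "S n \<in> measurable N (count_space UNIV)" for n
    using S by (simp add: network_random_walk_def)
  have gm[measurable]: "(\<lambda>\<omega>. f (S n \<omega>)) \<in> borel_measurable N" for f :: "_ \<Rightarrow> ennreal" and n
    by (rule measurable_compose[OF Sm]) simp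
  define Z where "Z = total_weight lam TYPE('d)"
  have Z: "Z > 0" unfolding Z_def by (rule total_weight_pos)
  define c where "c = (exp lam - 1) / Z"
  have c: "c > 0" using Z lam by (simp add: c_def)
  define h where "h = (\<lambda>v :: 'd vertex. ennreal (min 1 (exp (- lam * (fst v - n)))))"
  let ?p = "\<lambda>m. emeasure N {\<omega>\<in>space N. fst (S m \<omega>) = n}"
  have step: "ennreal c * ?p m + (\<integral>\<^sup>+\<omega>. h (S (Suc m) \<omega>) \<partial>N) \<le> (\<integral>\<^sup>+\<omega>. h (S m \<omega>) \<partial>N)" for m
  proof -
    have "ennreal c * ?p m = (\<integral>\<^sup>+\<omega>. ennreal c * indicator {\<omega>\<in>space N. fst (S m \<omega>) = n} \<omega> \<partial>N)"
      using measurable_sets[OF Sm, of "{v. fst v = n}" m]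
      by (intro nn_integral_cmult_indicator[symmetric]) (simp add: vimage_def Int_def conj_commute)
    also have "\<dots> = (\<integral>\<^sup>+\<omega>. ennreal c * indicator {v. fst v = n} (S m \<omega>) \<partial>N)"
      by (intro nn_integral_cong) (auto split: split_indicator)
    finally have "ennreal c * ?p m + (\<integral>\<^sup>+\<omega>. h (S (Suc m) \<omega>) \<partial>N) =
        (\<integral>\<^sup>+\<omega>. ennreal c * indicator {v. fst v = n} (S m \<omega>) + walk_op lam h (S m \<omega>) \<partial>N)"
      unfolding nn_integral_walk_Suc[OF S] by (simp add: nn_integral_add)
    also have "\<dots> \<le> (\<integral>\<^sup>+\<omega>. h (S m \<omega>) \<partial>N)"
      unfolding c_def Z_def h_def by (intro nn_integral_mono vertical_potential lam)
    finally show ?thesis .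
  qed
  \<comment> \<open>The remaining potential stays on the left, so that telescoping needs no
    subtraction in \<open>ennreal\<close>.\<close>
  have telescope: "(\<Sum>m<j. ennreal c * ?p m) + (\<integral>\<^sup>+\<omega>. h (S j \<omega>) \<partial>N) \<le> 1" for j
  proof (induction j)
    case 0
    have "(\<integral>\<^sup>+\<omega>. h (S 0 \<omega>) \<partial>N) \<le> (\<integral>\<^sup>+\<omega>. 1 \<partial>N)"
      by (intro nn_integral_mono) (simp add: h_def)
    then show ?case by (simp add: emeasure_space_1)
  next
    case (Suc j)
    have "(\<Sum>m<Suc j. ennreal c * ?p m) + (\<integral>\<^sup>+\<omega>. h (S (Suc j) \<omega>) \<partial>N) =
        (\<Sum>m<j. ennreal c * ?p m) + (ennreal c * ?p j + (\<integral>\<^sup>+\<omega>. h (S (Suc j) \<omega>) \<partial>N))"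
      by (simp add: add.assoc)
    also have "\<dots> \<le> (\<Sum>m<j. ennreal c * ?p m) + (\<integral>\<^sup>+\<omega>. h (S j \<omega>) \<partial>N)"
      by (intro add_left_mono step)
    finally show ?case using Suc.IH by (rule order_trans)
  qed
  have "(\<Sum>m<j. ennreal c * ?p m) \<le> 1" for j
    by (rule order_trans[OF _ telescope[of j]]) simp
  then have "(\<Sum>m. ennreal c * ?p m) \<le> 1"
    by (intro suminf_le_const) auto
  then have *: "ennreal c * (\<Sum>m. ?p m) \<le> 1" by simp
  have "(\<Sum>m. ?p m) = ennreal (1 / c) * (ennreal c * (\<Sum>m. ?p m))"
    using c by (simp add: mult.assoc[symmetric] flip: ennreal_mult)
  also have "\<dots> \<le> ennreal (1 / c) * 1" by (intro mult_left_mono *) auto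
  finally show ?thesis by (simp add: c_def Z_def)
qed

section \<open>Uniform bounds on the transition probabilities\<close>

text \<open>Up to the factor \<open>sqrt 2 ^ d\<close>, \<open>kernel_bound lam m n k\<close> dominates the probability that \<open>m\<close> steps of
  the walk raise the level by \<open>n\<close> and end at any prescribed horizontal point, after each horizontal
  coordinate \<open>i\<close> has in addition made \<open>k i\<close> simple random walk steps.\<close>

fun kernel_bound :: "real \<Rightarrow> nat \<Rightarrow> int \<Rightarrow> ('d::finite \<Rightarrow> nat) \<Rightarrow> ennreal" where
  "kernel_bound lam 0 n k = (if n = 0 then ennreal (decay k) else 0)"
| "kernel_bound lam (Suc m) n k =
    ennreal (exp lam / total_weight lam TYPE('d)) * kernel_bound lam m (n - 1) k +
    ennreal (1 / total_weight lam TYPE('d)) * kernel_bound lam m (n + 1) k +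
    (\<Sum>i\<in>UNIV. ennreal (2 / total_weight lam TYPE('d)) * kernel_bound lam m n (k(i := Suc (k i))))"

definition probe :: "int \<Rightarrow> int ^ 'd \<Rightarrow> ('d::finite \<Rightarrow> nat) \<Rightarrow> 'd vertex \<Rightarrow> ennreal" where
  "probe \<nu> \<xi> k u = (if fst u = \<nu> then ennreal (\<Prod>i\<in>UNIV. srw_kernel (k i) (snd u $ i - \<xi> $ i)) else 0)"

text \<open>Probes generalise the indicator of a vertex so that the one-step operator maps a probe to a
  combination of probes; a horizontal step in direction \<open>i\<close> increments \<open>k i\<close>.\<close>

lemma probe_0: "probe \<nu> \<xi> (\<lambda>_. 0) u = indicator {(\<nu>, \<xi>)} u"
proof -
  have "(\<Prod>i\<in>UNIV. srw_kernel 0 (snd u $ i - \<xi> $ i)) = (if snd u = \<xi> then 1 else 0)"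
    by (auto simp: vec_eq_iff prod_zero_iff)
  then show ?thesis by (cases u) (auto simp: probe_def)
qed

text \<open>A step in direction \<open>i\<close> affects only the factor of coordinate
  \<open>i\<close>, where adding the two neighbours is the recursion of \<open>srw_kernel\<close>
  without its factor 1/2.\<close>

lemma probe_axis:
  fixes x :: "int ^ 'd::finite"
  shows "probe \<nu> \<xi> k (n, x + axis i 1) + probe \<nu> \<xi> k (n, x - axis i 1) = 2 * probe \<nu> \<xi> (k(i := Suc (k i))) (n, x)"
proof -
  let ?f = "\<lambda>k (x :: int ^ 'd) j. srw_kernel (k j) (x $ j - \<xi> $ j)"
  let ?r = "\<Prod>j\<in>UNIV - {i}. ?f k x j"
  have r: "?r \<ge> 0" by (intro prod_nonneg) auto
  have eq: "(\<Prod>j\<in>UNIV. ?f k' y j) = ?f k' y i * ?r" if "\<And>j. j \<noteq> i \<Longrightarrow> k' j = k j" "\<And>j. j \<noteq> i \<Longrightarrow> y $ j = x $ j" for k' y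
  proof -
    have "(\<Prod>j\<in>UNIV. ?f k' y j) = ?f k' y i * (\<Prod>j\<in>UNIV - {i}. ?f k' y j)" by (rule prod.remove) auto
    also have "(\<Prod>j\<in>UNIV - {i}. ?f k' y j) = ?r" using that by (intro prod.cong) auto
    finally show ?thesis .
  qed
  have "(\<Prod>j\<in>UNIV. ?f k (x + axis i 1) j) + (\<Prod>j\<in>UNIV. ?f k (x - axis i 1) j) =
      2 * (\<Prod>j\<in>UNIV. ?f (k(i := Suc (k i))) x j)"
  proof -
    have "(\<Prod>j\<in>UNIV. ?f k (x + axis i 1) j) = srw_kernel (k i) (x $ i - \<xi> $ i + 1) * ?r"
      by (subst eq) (auto simp: axis_def algebra_simps)
    moreover have "(\<Prod>j\<in>UNIV. ?f k (x - axis i 1) j) = srw_kernel (k i) (x $ i - \<xi> $ i - 1) * ?r"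
      by (subst eq) (auto simp: axis_def algebra_simps)
    moreover have "(\<Prod>j\<in>UNIV. ?f (k(i := Suc (k i))) x j) = srw_kernel (Suc (k i)) (x $ i - \<xi> $ i) * ?r"
      by (subst eq) auto
    ultimately show ?thesis by (simp add: distrib_right)
  qed
  then show ?thesis
    by (auto simp: probe_def prod_nonneg ennreal_mult simp flip: ennreal_plus ennreal_numeral)
qed

text \<open>A vertical step of the walk amounts to shifting the target level the opposite way;
  \<open>probe_axis\<close> handles the horizontal steps.\<close>

lemma walk_op_probe:
  fixes lam :: real and u :: "('d::finite) vertex"
  defines "Z \<equiv> total_weight lam TYPE('d)"
  shows "walk_op lam (probe \<nu> \<xi> k) u = ennreal (exp lam / Z) * probe (\<nu> - 1) \<xi> k u + ennreal (1 / Z) * probe (\<nu> + 1) \<xi> k u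
    + (\<Sum>i\<in>UNIV. ennreal (2 / Z) * probe \<nu> \<xi> (k(i := Suc (k i))) u)"
proof -
  obtain n x where u: "u = (n, x)" by (cases u)
  have Z: "Z > 0" unfolding Z_def by (rule total_weight_pos)
  have 2: "ennreal (1 / Z) * (2 * y) = ennreal (2 / Z) * y" for y
  proof -
    have "ennreal (2 / Z) = ennreal (1 / Z) * 2" using Z by (simp flip: ennreal_mult ennreal_numeral)
    then show ?thesis by (simp add: mult.assoc)
  qed
  have v: "probe \<nu> \<xi> k (n + 1, x) = probe (\<nu> - 1) \<xi> k (n, x)" "probe \<nu> \<xi> k (n - 1, x) = probe (\<nu> + 1) \<xi> k (n, x)"
    by (auto simp: probe_def)
  show ?thesis unfolding u walk_op_eq Z_def[symmetric] probe_axis 2 v ..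
qed

lemma probe_le: "probe \<nu> \<xi> k (u :: ('d::finite) vertex) \<le> ennreal (sqrt 2 ^ CARD('d)) * kernel_bound lam 0 (\<nu> - fst u) k"
proof -
  have "(\<Prod>i\<in>UNIV. srw_kernel (k i) (snd u $ i - \<xi> $ i)) \<le> (\<Prod>i\<in>UNIV. sqrt 2 * (1 / sqrt (real (Suc (k i)))))"
    using srw_kernel_bound by (intro prod_mono) auto
  also have "\<dots> = sqrt 2 ^ CARD('d) * decay k" by (simp only: prod.distrib prod_constant decay_def)
  finally show ?thesis by (auto simp: probe_def simp flip: ennreal_mult)
qed

text \<open>Removing the last step turns a probe into a combination of probes with other \<nu> and
  \<open>k\<close>, hence the generalised induction; the coefficients are those of
  \<open>kernel_bound\<close>. The bound is uniform in the horizontal target \<xi>.\<close>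

lemma nn_integral_probe_le:
  fixes S :: "nat \<Rightarrow> 'w \<Rightarrow> ('d::finite) vertex"
  assumes S: "network_random_walk N lam S" and start: "AE \<omega> in N. S 0 \<omega> = a"
  shows "(\<integral>\<^sup>+\<omega>. probe \<nu> \<xi> k (S m \<omega>) \<partial>N) \<le> ennreal (sqrt 2 ^ CARD('d)) * kernel_bound lam m (\<nu> - fst a) k"
proof (induction m arbitrary: \<nu> k)
  case 0
  interpret prob_space N using S by (simp add: network_random_walk_def)
  have "(\<integral>\<^sup>+\<omega>. probe \<nu> \<xi> k (S 0 \<omega>) \<partial>N) = (\<integral>\<^sup>+\<omega>. probe \<nu> \<xi> k a \<partial>N)"
    using start by (intro nn_integral_cong_AE) auto
  then show ?case using probe_le by (simp add: emeasure_space_1 del: kernel_bound.simps)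
next
  case (Suc m)
  have Sm: "S n \<in> measurable N (count_space UNIV)" for n
    using S by (simp add: network_random_walk_def)
  have gm[measurable]: "(\<lambda>\<omega>. f (S n \<omega>)) \<in> borel_measurable N" for f :: "_ \<Rightarrow> ennreal" and n
    by (rule measurable_compose[OF Sm]) simp
  let ?Z = "total_weight lam TYPE('d)" and ?C = "ennreal (sqrt 2 ^ CARD('d))"
  let ?I = "\<lambda>\<nu> k. \<integral>\<^sup>+\<omega>. probe \<nu> \<xi> k (S m \<omega>) \<partial>N"
  have "(\<integral>\<^sup>+\<omega>. probe \<nu> \<xi> k (S (Suc m) \<omega>) \<partial>N) =
      ennreal (exp lam / ?Z) * ?I (\<nu> - 1) k + ennreal (1 / ?Z) * ?I (\<nu> + 1) k
       + (\<Sum>i\<in>UNIV. ennreal (2 / ?Z) * ?I \<nu> (k(i := Suc (k i))))"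
    unfolding nn_integral_walk_Suc[OF S] walk_op_probe
    by (simp add: nn_integral_add nn_integral_cmult nn_integral_sum)
  also have "\<dots> \<le> ennreal (exp lam / ?Z) * (?C * kernel_bound lam m (\<nu> - 1 - fst a) k) 
       + ennreal (1 / ?Z) * (?C * kernel_bound lam m (\<nu> + 1 - fst a) k)
       + (\<Sum>i\<in>UNIV. ennreal (2 / ?Z) * (?C * kernel_bound lam m (\<nu> - fst a) (k(i := Suc (k i)))))"
    by (intro add_mono sum_mono mult_left_mono Suc.IH) auto
  also have "\<dots> = ?C * kernel_bound lam (Suc m) (\<nu> - fst a) k"
    by (simp add: distrib_left sum_distrib_left mult_ac algebra_simps)
  finally show ?case .
qed

section \<open>Summation over levels and times\<close>

text \<open>Summing over the levels forgets the vertical coordinate. What remains is the expectation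
  of \<open>decay\<close> after \<open>m\<close> steps of the direction counts started from
  \<open>k\<close>.\<close>

definition level_sum :: "real \<Rightarrow> nat \<Rightarrow> ('d::finite \<Rightarrow> nat) \<Rightarrow> ennreal" where
  "level_sum lam m k = (\<integral>\<^sup>+n. kernel_bound lam m n k \<partial>count_space UNIV)"

lemma nn_integral_int_shift: "(\<integral>\<^sup>+n. f (n + c) \<partial>count_space UNIV) = (\<integral>\<^sup>+n. f n \<partial>count_space (UNIV :: int set))"
  by (rule nn_integral_bij_count_space[where g = "\<lambda>n. n + c"]) (rule bij_plus_right)

lemma level_sum_0: "level_sum lam 0 k = ennreal (decay k)"
proof -
  have "level_sum lam 0 k = (\<integral>\<^sup>+n. ennreal (decay k) * indicator {0::int} n \<partial>count_space UNIV)"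
    unfolding level_sum_def by (intro nn_integral_cong) auto
  then show ?thesis by simp
qed

lemma level_sum_Suc:
  fixes lam :: real and k :: "'d::finite \<Rightarrow> nat"
  defines "Z \<equiv> total_weight lam TYPE('d)"
  shows "level_sum lam (Suc m) k = ennreal (exp lam / Z) * level_sum lam m k + ennreal (1 / Z) * level_sum lam m k
    + (\<Sum>i\<in>UNIV. ennreal (2 / Z) * level_sum lam m (k(i := Suc (k i))))"
  unfolding level_sum_def kernel_bound.simps Z_def[symmetric]
  using nn_integral_int_shift[of "\<lambda>n. kernel_bound lam m n k" 1] nn_integral_int_shift[of "\<lambda>n. kernel_bound lam m n k" "-1"]
  by (simp add: nn_integral_add nn_integral_cmult nn_integral_sum)

text \<open>The partial sums stay below \<open>c * lyapunov k\<close> for all \<open>k\<close> at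
  once: after the first term \<open>decay k\<close> is split off, the rest is one step of the count
  chain applied to a shorter sum, and the drift of \<open>lyapunov\<close> pays for the first
  term.\<close>

lemma level_sum_summable:
  fixes k :: "'d::finite \<Rightarrow> nat"
  assumes d: "CARD('d) \<ge> 3"
  shows "(\<Sum>m. level_sum lam m k) < \<top>"
proof -
  define Z where "Z = total_weight lam TYPE('d)"
  define d where "d = real CARD('d)"
  have Z: "Z > 0" unfolding Z_def by (rule total_weight_pos)
  have Z': "Z = exp lam + 1 + 2 * d" by (simp add: Z_def d_def total_weight_def)
  have d3: "d \<ge> 3" using d by (simp add: d_def)
  \<comment> \<open>Chosen so that \<open>2 * c / Z\<close>, the weight of the drift inequality
    below, turns its coefficient \<open>d^2/2 - d\<close> into 1.\<close>
  define c where "c = Z / (d * (d - 2))"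
  have c: "c > 0" using Z d3 by (simp add: c_def)
  have "(\<Sum>m<j. level_sum lam m k) \<le> ennreal (c * lyapunov k)" for j
  proof (induction j arbitrary: k)
    case 0
    then show ?case by simp
  next
    case (Suc j)
    let ?k = "\<lambda>i. k(i := Suc (k i))"
    have real: "decay k + exp lam / Z * (c * lyapunov k) + 1 / Z * (c * lyapunov k)
        + (\<Sum>i\<in>UNIV. 2 / Z * (c * lyapunov (?k i))) \<le> c * lyapunov k"
    proof -
      have "(2 * c / Z) * ((\<Sum>i\<in>UNIV. lyapunov (?k i)) + (d\<^sup>2 / 2 - d) * decay k) \<le> (2 * c / Z) * (d * lyapunov k)"
        using lyapunov_drift[of k] c Z unfolding d_def by (intro mult_left_mono) auto
      moreover have "(2 * c / Z) * (d\<^sup>2 / 2 - d) = 1"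
        using Z d3 by (simp add: c_def power2_eq_square field_simps)
      moreover have "(\<Sum>i\<in>UNIV. 2 / Z * (c * lyapunov (?k i))) = (2 * c / Z) * (\<Sum>i\<in>UNIV. lyapunov (?k i))"
        by (simp add: sum_distrib_left mult.assoc)
      moreover have "exp lam / Z * (c * lyapunov k) + 1 / Z * (c * lyapunov k) + (2 * c / Z) * (d * lyapunov k) = c * lyapunov k"
      proof -
        have "exp lam / Z * (c * lyapunov k) + 1 / Z * (c * lyapunov k) + (2 * c / Z) * (d * lyapunov k) 
          = c * lyapunov k * (exp lam + 1 + 2 * d) / Z" by (simp add: add_divide_distrib algebra_simps)
        then show ?thesis using Z by (simp flip: Z')
      qed
      ultimately show ?thesis by (simp only: distrib_left mult.assoc[symmetric])
    qed
    have "(\<Sum>m<Suc j. level_sum lam m k) = level_sum lam 0 k + (\<Sum>m<j. level_sum lam (Suc m) k)"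
      by (rule sum.lessThan_Suc_shift)
    also have "\<dots> = ennreal (decay k) + ennreal (exp lam / Z) * (\<Sum>m<j. level_sum lam m k) + ennreal (1 / Z) * (\<Sum>m<j. level_sum lam m k)
       + (\<Sum>i\<in>UNIV. ennreal (2 / Z) * (\<Sum>m<j. level_sum lam m (?k i)))"
      unfolding level_sum_0 level_sum_Suc Z_def[symmetric] sum.distrib sum_distrib_left
      by (simp only: add.assoc sum.swap[of _ UNIV "{..<j}"])
    also have "\<dots> \<le> ennreal (decay k) + ennreal (exp lam / Z) * ennreal (c * lyapunov k) + ennreal (1 / Z) * ennreal (c * lyapunov k)
       + (\<Sum>i\<in>UNIV. ennreal (2 / Z) * ennreal (c * lyapunov (?k i)))"
      by (intro add_mono sum_mono mult_left_mono Suc.IH order_refl) auto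
    also have "\<dots> = ennreal (decay k + exp lam / Z * (c * lyapunov k) + 1 / Z * (c * lyapunov k)
        + (\<Sum>i\<in>UNIV. 2 / Z * (c * lyapunov (?k i))))"
      using Z c by (simp add: sum_nonneg sum_ennreal flip: ennreal_mult ennreal_plus)
    also have "\<dots> \<le> ennreal (c * lyapunov k)" by (rule ennreal_leI[OF real])
    finally show ?case .
  qed
  then have "(\<Sum>m. level_sum lam m k) \<le> ennreal (c * lyapunov k)"
    by (intro suminf_le_const) auto
  then show ?thesis by (rule le_less_trans) simp
qed

section \<open>Crossings\<close>

lemma nn_integral_discrete:
  fixes X :: "'w \<Rightarrow> 'a::countable"
  assumes X[measurable]: "X \<in> measurable N (count_space UNIV)"
  shows "(\<integral>\<^sup>+\<omega>. f (X \<omega>) \<partial>N) = (\<integral>\<^sup>+z. f z * emeasure N {\<omega>\<in>space N. X \<omega> = z} \<partial>count_space UNIV)"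
proof -
  have "(\<integral>\<^sup>+\<omega>. f (X \<omega>) \<partial>N) = (\<integral>\<^sup>+\<omega>. (\<integral>\<^sup>+z. f z * indicator {\<omega>\<in>space N. X \<omega> = z} \<omega> \<partial>count_space UNIV) \<partial>N)"
  proof (intro nn_integral_cong)
    fix \<omega> assume "\<omega> \<in> space N"
    then have "(\<integral>\<^sup>+z. f z * indicator {\<omega>\<in>space N. X \<omega> = z} \<omega> \<partial>count_space UNIV) =
        (\<integral>\<^sup>+z. f (X \<omega>) * indicator {X \<omega>} z \<partial>count_space UNIV)"
      by (intro nn_integral_cong) (auto split: split_indicator)
    then show "f (X \<omega>) = (\<integral>\<^sup>+z. f z * indicator {\<omega>\<in>space N. X \<omega> = z} \<omega> \<partial>count_space UNIV)" by simp
  qed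
  also have "\<dots> = (\<integral>\<^sup>+z. (\<integral>\<^sup>+\<omega>. f z * indicator {\<omega>\<in>space N. X \<omega> = z} \<omega> \<partial>N) \<partial>count_space UNIV)"
    by (rule nn_integral_count_space_nn_integral) auto
  also have "\<dots> = (\<integral>\<^sup>+z. f z * emeasure N {\<omega>\<in>space N. X \<omega> = z} \<partial>count_space UNIV)"
    by (intro nn_integral_cong) (simp add: nn_integral_cmult)
  finally show ?thesis .
qed

text \<open>Splitting by the common vertex and using independence gives a sum of products. The
  factor of \<open>S\<close> is bounded through the level of the vertex alone.\<close>

lemma crossing_prob_le:
  fixes S S' :: "nat \<Rightarrow> 'w \<Rightarrow> ('d::finite) vertex"
  assumes S: "network_random_walk N lam S" and S': "network_random_walk N lam S'"
    and ind: "prob_space.indep_var N path_space (\<lambda>\<omega> n. S n \<omega>) path_space (\<lambda>\<omega> n. S' n \<omega>)"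
    and start: "AE \<omega> in N. S 0 \<omega> = a"
  shows "emeasure N {\<omega>\<in>space N. S m \<omega> = S' m' \<omega>} \<le>
    (\<integral>\<^sup>+n. ennreal (sqrt 2 ^ CARD('d)) * kernel_bound lam m (n - fst a) (\<lambda>_ :: 'd. 0) *
       emeasure N {\<omega>\<in>space N. fst (S' m' \<omega>) = n} \<partial>count_space UNIV)"
proof -
  interpret prob_space N using S by (simp add: network_random_walk_def)
  have Sm[measurable]: "S n \<in> measurable N (count_space UNIV)" for n
    using S by (simp add: network_random_walk_def)
  have S'm[measurable]: "S' n \<in> measurable N (count_space UNIV)" for n
    using S' by (simp add: network_random_walk_def)
  have V'm[measurable]: "(\<lambda>\<omega>. fst (S' n \<omega>)) \<in> measurable N (count_space UNIV)" for n
    by (rule measurable_compose[OF S'm]) simp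
  let ?K = "\<lambda>n. ennreal (sqrt 2 ^ CARD('d)) * kernel_bound lam m (n - fst a) (\<lambda>_ :: 'd. 0)"
  let ?p = "\<lambda>z. emeasure N {\<omega>\<in>space N. S m \<omega> = z}" and ?p' = "\<lambda>z. emeasure N {\<omega>\<in>space N. S' m' \<omega> = z}"
  have cyl: "{s. s n = z} \<in> sets path_space" for n and z :: "'d vertex"
  proof -
    have "{s \<in> space path_space. s n = z} \<in> sets path_space" by measurable
    then show ?thesis by (simp add: space_PiM)
  qed
  have p: "?p z \<le> ?K (fst z)" for z
  proof -
    have "?p z = (\<integral>\<^sup>+\<omega>. indicator {\<omega>\<in>space N. S m \<omega> = z} \<omega> \<partial>N)" by simp
    also have "\<dots> = (\<integral>\<^sup>+\<omega>. probe (fst z) (snd z) (\<lambda>_. 0) (S m \<omega>) \<partial>N)"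
      by (intro nn_integral_cong) (auto simp: probe_0 split: split_indicator)
    also have "\<dots> \<le> ?K (fst z)" by (rule nn_integral_probe_le[OF S start])
    finally show ?thesis .
  qed
  have "emeasure N {\<omega>\<in>space N. S m \<omega> = S' m' \<omega>} = (\<integral>\<^sup>+\<omega>. indicator {\<omega>\<in>space N. S m \<omega> = S' m' \<omega>} \<omega> \<partial>N)"
    by (rule nn_integral_indicator[symmetric]) measurable
  also have "\<dots> = (\<integral>\<^sup>+\<omega>. (\<integral>\<^sup>+z. indicator {\<omega>\<in>space N. S m \<omega> = z \<and> S' m' \<omega> = z} \<omega> \<partial>count_space UNIV) \<partial>N)"
  proof (intro nn_integral_cong)
    fix \<omega> assume "\<omega> \<in> space N"
    then have "(\<integral>\<^sup>+z. indicator {\<omega>\<in>space N. S m \<omega> = z \<and> S' m' \<omega> = z} \<omega> \<partial>count_space UNIV) =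
       (\<integral>\<^sup>+z. indicator {\<omega>\<in>space N. S m \<omega> = S' m' \<omega>} \<omega> * indicator {S m \<omega>} z \<partial>count_space UNIV)"
      by (intro nn_integral_cong) (auto split: split_indicator)
    then show "indicator {\<omega>\<in>space N. S m \<omega> = S' m' \<omega>} \<omega> =
       (\<integral>\<^sup>+z. indicator {\<omega>\<in>space N. S m \<omega> = z \<and> S' m' \<omega> = z} \<omega> \<partial>count_space UNIV)" by simp
  qed
  also have "\<dots> = (\<integral>\<^sup>+z. (\<integral>\<^sup>+\<omega>. indicator {\<omega>\<in>space N. S m \<omega> = z \<and> S' m' \<omega> = z} \<omega> \<partial>N) \<partial>count_space UNIV)"
    by (rule nn_integral_count_space_nn_integral) auto
  also have "\<dots> = (\<integral>\<^sup>+z. ?p z * ?p' z \<partial>count_space UNIV)"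
  proof (intro nn_integral_cong)
    fix z
    have "prob {\<omega>\<in>space N. S m \<omega> = z \<and> S' m' \<omega> = z} = prob {\<omega>\<in>space N. S m \<omega> = z} * prob {\<omega>\<in>space N. S' m' \<omega> = z}"
      using indep_var_prod[OF prob_space_axioms ind cyl[of m z] cyl[of m' z]] by simp
    then show "(\<integral>\<^sup>+\<omega>. indicator {\<omega>\<in>space N. S m \<omega> = z \<and> S' m' \<omega> = z} \<omega> \<partial>N) = ?p z * ?p' z"
      by (simp add: emeasure_eq_measure ennreal_mult)
  qed
  also have "\<dots> \<le> (\<integral>\<^sup>+z. ?K (fst z) * ?p' z \<partial>count_space UNIV)"
    by (intro nn_integral_mono mult_right_mono p) auto
  \<comment> \<open>The bound sees only the level of the vertex, so the sum over vertices collapses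
    to the law of the level of \<open>S'\<close> at time \<open>m'\<close>.\<close>
  also have "\<dots> = (\<integral>\<^sup>+\<omega>. ?K (fst (S' m' \<omega>)) \<partial>N)"
    by (rule nn_integral_discrete[OF S'm, symmetric])
  also have "\<dots> = (\<integral>\<^sup>+n. ?K n * emeasure N {\<omega>\<in>space N. fst (S' m' \<omega>) = n} \<partial>count_space UNIV)"
    by (rule nn_integral_discrete[OF V'm])
  finally show ?thesis .
qed

text \<open>Summing over \<open>m'\<close> first replaces the level law of \<open>S'\<close> by the
  constant \<open>?G\<close>; the sum over levels then produces \<open>level_sum\<close>, which is
  summable over \<open>m\<close>.\<close>

lemma expected_crossings_finite:
  fixes S S' :: "nat \<Rightarrow> 'w \<Rightarrow> ('d::finite) vertex"
  assumes d: "CARD('d) \<ge> 3" and lam: "lam > 0"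
    and S: "network_random_walk N lam S" and S': "network_random_walk N lam S'"
    and ind: "prob_space.indep_var N path_space (\<lambda>\<omega> n. S n \<omega>) path_space (\<lambda>\<omega> n. S' n \<omega>)"
    and start: "AE \<omega> in N. S 0 \<omega> = a"
  shows "(\<Sum>m. \<Sum>m'. emeasure N {\<omega>\<in>space N. S m \<omega> = S' m' \<omega>}) < \<top>"
proof -
  let ?C = "ennreal (sqrt 2 ^ CARD('d))" and ?G = "ennreal (total_weight lam TYPE('d) / (exp lam - 1))"
  let ?k = "\<lambda>_ :: 'd. 0 :: nat"
  let ?q = "\<lambda>m' n. emeasure N {\<omega>\<in>space N. fst (S' m' \<omega>) = n}"
  have "(\<Sum>m'. emeasure N {\<omega>\<in>space N. S m \<omega> = S' m' \<omega>}) \<le> ?C * ?G * level_sum lam m ?k" for m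
  proof -
    have "(\<Sum>m'. emeasure N {\<omega>\<in>space N. S m \<omega> = S' m' \<omega>}) \<le>
        (\<Sum>m'. \<integral>\<^sup>+n. ?C * kernel_bound lam m (n - fst a) ?k * ?q m' n \<partial>count_space UNIV)"
      by (intro suminf_le crossing_prob_le[OF S S' ind start]) auto
    also have "\<dots> = (\<integral>\<^sup>+n. (\<Sum>m'. ?C * kernel_bound lam m (n - fst a) ?k * ?q m' n) \<partial>count_space UNIV)"
      by (rule nn_integral_suminf[symmetric]) auto
    also have "\<dots> = (\<integral>\<^sup>+n. ?C * kernel_bound lam m (n - fst a) ?k * (\<Sum>m'. ?q m' n) \<partial>count_space UNIV)"
      by simp
    also have "\<dots> \<le> (\<integral>\<^sup>+n. ?C * kernel_bound lam m (n - fst a) ?k * ?G \<partial>count_space UNIV)"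
      by (intro nn_integral_mono mult_left_mono vertical_green_bound lam S') auto
    also have "\<dots> = (\<integral>\<^sup>+n. ?C * ?G * kernel_bound lam m (n + - fst a) ?k \<partial>count_space UNIV)"
      by (simp add: mult_ac)
    also have "\<dots> = ?C * ?G * (\<integral>\<^sup>+n. kernel_bound lam m (n + - fst a) ?k \<partial>count_space UNIV)"
      by (rule nn_integral_cmult) auto
    also have "(\<integral>\<^sup>+n. kernel_bound lam m (n + - fst a) ?k \<partial>count_space UNIV) = level_sum lam m ?k"
      unfolding level_sum_def by (rule nn_integral_int_shift)
    finally show ?thesis .
  qed
  then have "(\<Sum>m. \<Sum>m'. emeasure N {\<omega>\<in>space N. S m \<omega> = S' m' \<omega>}) \<le> (\<Sum>m. ?C * ?G * level_sum lam m ?k)"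
    by (intro suminf_le) auto
  also have "\<dots> = ?C * ?G * (\<Sum>m. level_sum lam m ?k)" by simp
  also have "\<dots> < \<top>"
    using level_sum_summable[OF d, of lam ?k] by (simp add: ennreal_mult_less_top)
  finally show ?thesis .
qed

lemma AE_finite_crossings:
  fixes S S' :: "nat \<Rightarrow> 'w \<Rightarrow> ('d::finite) vertex"
  assumes Sm[measurable]: "\<And>n. S n \<in> measurable N (count_space UNIV)"
    and S'm[measurable]: "\<And>n. S' n \<in> measurable N (count_space UNIV)"
    and fin: "(\<Sum>m. \<Sum>m'. emeasure N {\<omega>\<in>space N. S m \<omega> = S' m' \<omega>}) < \<top>"
  shows "AE \<omega> in N. finite {(m, m'). S m \<omega> = S' m' \<omega>}"
proof -
  let ?i = "\<lambda>m m' \<omega>. indicator {\<omega>\<in>space N. S m \<omega> = S' m' \<omega>} \<omega> :: ennreal"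
  have ev[measurable]: "{\<omega>\<in>space N. S m \<omega> = S' m' \<omega>} \<in> sets N" for m m' by measurable
  have "(\<integral>\<^sup>+\<omega>. (\<Sum>m. \<Sum>m'. ?i m m' \<omega>) \<partial>N) = (\<Sum>m. \<Sum>m'. emeasure N {\<omega>\<in>space N. S m \<omega> = S' m' \<omega>})"
    by (simp add: nn_integral_suminf)
  then have "AE \<omega> in N. (\<Sum>m. \<Sum>m'. ?i m m' \<omega>) \<noteq> \<infinity>"
    using fin by (intro nn_integral_noteq_infinite) auto
  then show ?thesis
  proof (rule AE_mp, intro AE_I2 impI)
    fix \<omega> assume w: "\<omega> \<in> space N" and fin: "(\<Sum>m. \<Sum>m'. ?i m m' \<omega>) \<noteq> \<infinity>"
    \<comment> \<open>The double series is the counting measure of the set of crossing pairs, so its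
      finiteness is that of the set.\<close>
    have "(\<Sum>m. \<Sum>m'. ?i m m' \<omega>) =
        (\<integral>\<^sup>+m. (\<integral>\<^sup>+m'. indicator {(m, m'). S m \<omega> = S' m' \<omega>} (m, m') \<partial>count_space UNIV) \<partial>count_space UNIV)"
      using w by (simp add: nn_integral_count_space_nat indicator_def)
    also have "\<dots> = (\<integral>\<^sup>+p. indicator {(m, m'). S m \<omega> = S' m' \<omega>} p \<partial>count_space UNIV)"
      by (rule nn_integral_fst_count_space)
    also have "\<dots> = emeasure (count_space UNIV) {(m, m'). S m \<omega> = S' m' \<omega>}" by simp
    finally have "emeasure (count_space UNIV) {(m, m'). S m \<omega> = S' m' \<omega>} \<noteq> \<infinity>"
      using fin by argo
    then show "finite {(m, m'). S m \<omega> = S' m' \<omega>}"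
      by (rule contrapos_np) simp
  qed
qed

section \<open>Removing the condition on the starting points\<close>

theorem mainTheorem5:
  fixes M :: "'w measure" and lam :: real
    and S S' :: "nat \<Rightarrow> 'w \<Rightarrow> int \<times> (int ^ 'd)"
  assumes "CARD('d) \<ge> 3" and "lam > 0"
    and "independent_network_random_walks M lam S S'"
  shows "AE \<omega> in M. finite {(m, m'). S m \<omega> = S' m' \<omega>}"
proof -
  interpret prob_space M using assms(3) by (simp add: independent_network_random_walks_def)
  have Sm[measurable]: "\<And>n. S n \<in> measurable M (count_space UNIV)"
    and S'm[measurable]: "\<And>n. S' n \<in> measurable M (count_space UNIV)"
    using assms(3) by (auto simp: independent_network_random_walks_def)
  \<comment> \<open>There are only countably many pairs of initial points, so each may be treated
    separately. A pair of probability zero is excluded almost surely; for any other, the conditional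
    law makes the walks independent with fixed starting points.\<close>
  have "AE \<omega> in M. S 0 \<omega> = fst ab \<and> S' 0 \<omega> = snd ab \<longrightarrow> finite {(m, m'). S m \<omega> = S' m' \<omega>}" for ab
  proof -
    define a b where "a = fst ab" and "b = snd ab"
    let ?E = "start_event M S S' a b"
    have E[measurable]: "?E \<in> sets M" by measurable
    show ?thesis
    proof (cases "prob ?E = 0")
      case True
      then have "AE \<omega> in M. \<not> (S 0 \<omega> = a \<and> S' 0 \<omega> = b)"
        by (subst AE_iff_measurable[OF E]) (auto simp: emeasure_eq_measure)
      then show ?thesis unfolding a_def b_def by eventually_elim auto
    next
      case False
      let ?N = "uniform_measure M ?E"
      have "network_random_walk ?N lam S" "network_random_walk ?N lam S'"
        "prob_space.indep_var ?N path_space (\<lambda>\<omega> n. S n \<omega>) path_space (\<lambda>\<omega> n. S' n \<omega>)"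
        using assms(3) False unfolding independent_network_random_walks_def Let_def by blast+
      moreover have "AE \<omega> in ?N. S 0 \<omega> = a"
        by (rule AE_uniform_measureI) auto
      ultimately have "(\<Sum>m. \<Sum>m'. emeasure ?N {\<omega>\<in>space ?N. S m \<omega> = S' m' \<omega>}) < \<top>"
        by (intro expected_crossings_finite[OF assms(1,2)])
      then have "AE \<omega> in ?N. finite {(m, m'). S m \<omega> = S' m' \<omega>}"
        using Sm S'm by (intro AE_finite_crossings) (auto simp: measurable_def)
      then have "AE \<omega> in M. \<omega> \<in> ?E \<longrightarrow> finite {(m, m'). S m \<omega> = S' m' \<omega>}"
        using False by (subst (asm) AE_uniform_measure) (auto simp: emeasure_eq_measure)
      then show ?thesis unfolding a_def b_def using AE_space[of M] by eventually_elim auto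
    qed
  qed
  then have "AE \<omega> in M. \<forall>ab. S 0 \<omega> = fst ab \<and> S' 0 \<omega> = snd ab \<longrightarrow> finite {(m, m'). S m \<omega> = S' m' \<omega>}"
    unfolding AE_all_countable by blast
  then show ?thesis by eventually_elim auto
qed

end
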